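(* Let $\mathcal{L}:\mathbb{F}^{q\times q}\to\mathbb{F}^{n\times n}$ be a $*$-linear matrix map ($\mathbb{F}=\mathbb{C}$ or $\mathbb{R}$) with matricization $L=[L_{ij}]$ and Choi matrix $\mathbb{L}$. Set $m=\operatorname{rank}\mathbb{L}$. Assume one can choose linearly independent $L_1,\ldots,L_m\in\mathbb{F}^{n\times q}$ among the block entries of $L$, say $L_k=L_{i_kj_k}$ for $k=1,\ldots,m$, in such a way that $i_k=i_l$ for all $k$ and $l$, or such that $j_k=j_l$ for all $k$ and $l$. Then $\mathfrak{Y}_{\widehat{A}}=\mathbb{F}^m$, and hence $\mathcal{L}$ is completely positive in case $\mathcal{L}$ is positive.
   Context: Notation: $^*$ denotes the adjoint (the transpose when $\mathbb{F}=\mathbb{R}$). A linear map $\mathcal{L}:\mathbb{F}^{q\times q}\to\mathbb{F}^{n\times n}$ is $*$-linear if $\mathcal{L}(V^* )=\mathcal{L}(V)^*$ for all $V$; positive if it maps positive semidefinite (Hermitian) matrices to positive semidefinite matrices; completely positive if for every $k\ge1$ the map $[V_{ab}]_{a,b=1}^k\mapsto[\mathcal{L}(V_{ab})]_{a,b=1}^k$ is positive (equivalently, the Choi matrix is positive semidefinite). The Choi matrix is $\mathbb{L}=[\mathcal{L}(\mathcal{E}_{ij}^{(q)})]_{i,j=1}^q\in\mathbb{F}^{nq\times nq}$, with $\mathcal{E}_{ij}^{(q)}$ the matrix units. With $\operatorname{vec}$ stacking columns, the matricization is the matrix $L\in\mathbb{F}^{n^2\times q^2}$ with $L\operatorname{vec}(V)=\operatorname{vec}(\mathcal{L}(V))$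 for all $V$, partitioned as $L=[L_{ij}]$ with blocks $L_{ij}\in\mathbb{F}^{n\times q}$, $1\le i\le n$, $1\le j\le q$. One has $\operatorname{rank}\mathbb{L}=\dim\operatorname{span}\{L_{ij}\}$, so a linearly independent choice $L_1,\ldots,L_m$ among the blocks is a basis of their span, and there are unique scalars with $L_{ij}=\sum_{k=1}^m\alpha_k^{ij}L_k$. Put $A_k=[\overline{\alpha_k^{ij}}]_{i,j}\in\mathbb{F}^{n\times q}$, define $\widehat{A}\in\mathbb{F}^{m\times nq}$ by $\widehat{A}^*=[\operatorname{vec}(A_1)\ \cdots\ \operatorname{vec}(A_m)]$, and set $\mathfrak{Y}_{\widehat{A}}=\{\widehat{A}(z\otimes x):x\in\mathbb{F}^n,\ z\in\mathbb{F}^q\}$, where $\otimes$ is the Kronecker product. *)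

theory Defs
  imports
    "Jordan_Normal_Form.Schur_Decomposition"
    "Jordan_Normal_Form.DL_Rank"
begin

text \<open>
  Matrices over \<open>F\<close> are Jordan-Normal-Form matrices, so all indices start at \<open>0\<close>. The adjoint
  is \<open>mat_adjoint\<close>; the class \<open>conjugatable_ordered_field\<close> has both scalar fields of
  interest as instances, \<open>conjugate\<close> being \<open>cnj\<close> on \<open>complex\<close> and the identity on \<open>real\<close>.
  A matrix map is a function on all of \<open>'a mat\<close>, of which only the values on
  \<open>carrier_mat q q\<close> matter.
\<close>

text \<open>
  On the complex numbers \<open>0 \<le> z\<close> is the order of \<open>HOL-Library.Complex_Order\<close>, which says that
  \<open>z\<close> is real and nonnegative. The adjoint condition is not redundant over the reals.
\<close>

definition psd_mat :: "nat \<Rightarrow> 'a::conjugatable_ordered_field mat \<Rightarrow> bool" where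
  "psd_mat n A \<longleftrightarrow> A \<in> carrier_mat n n \<and> mat_adjoint A = A \<and>
     (\<forall>v\<in>carrier_vec n. 0 \<le> (A *\<^sub>v v) \<bullet>c v)"

definition star_linear ::
    "nat \<Rightarrow> nat \<Rightarrow> ('a::conjugatable_field mat \<Rightarrow> 'a mat) \<Rightarrow> bool" where
  "star_linear n q \<L> \<longleftrightarrow>
     linear_map class_ring (module_mat TYPE('a) q q) (module_mat TYPE('a) n n) \<L> \<and>
     (\<forall>V\<in>carrier_mat q q. \<L> (mat_adjoint V) = mat_adjoint (\<L> V))"

definition positive_map ::
    "nat \<Rightarrow> nat \<Rightarrow> ('a::conjugatable_ordered_field mat \<Rightarrow> 'a mat) \<Rightarrow> bool" where
  "positive_map n q \<L> \<longleftrightarrow> (\<forall>V. psd_mat q V \<longrightarrow> psd_mat n (\<L> V))"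

text \<open>The \<open>k \<times> k\<close> block matrix with \<open>n \<times> n\<close> blocks \<open>B a b\<close>.\<close>

definition block_mat :: "nat \<Rightarrow> nat \<Rightarrow> (nat \<Rightarrow> nat \<Rightarrow> 'a mat) \<Rightarrow> 'a mat" where
  "block_mat k n B =
     mat (k * n) (k * n) (\<lambda>(r, s). B (r div n) (s div n) $$ (r mod n, s mod n))"

definition completely_positive_map ::
    "nat \<Rightarrow> nat \<Rightarrow> ('a::conjugatable_ordered_field mat \<Rightarrow> 'a mat) \<Rightarrow> bool" where
  "completely_positive_map n q \<L> \<longleftrightarrow>
     (\<forall>k\<ge>1. \<forall>V. (\<forall>a<k. \<forall>b<k. V a b \<in> carrier_mat q q) \<longrightarrow>
        psd_mat (k * q) (block_mat k q V) \<longrightarrow>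
        psd_mat (k * n) (block_mat k n (\<lambda>a b. \<L> (V a b))))"

definition unit_mat :: "nat \<Rightarrow> nat \<Rightarrow> nat \<Rightarrow> 'a::zero_neq_one mat" where
  "unit_mat q i j = mat q q (\<lambda>rs. if rs = (i, j) then 1 else 0)"

definition choi_mat ::
    "nat \<Rightarrow> nat \<Rightarrow> ('a::zero_neq_one mat \<Rightarrow> 'a mat) \<Rightarrow> 'a mat" where
  "choi_mat n q \<L> = block_mat q n (\<lambda>i j. \<L> (unit_mat q i j))"

text \<open>Column stacking; the name \<open>vec\<close> is taken by the vector constructor.\<close>

definition vec_stack :: "'a mat \<Rightarrow> 'a vec" where
  "vec_stack A =
     vec (dim_row A * dim_col A) (\<lambda>k. A $$ (k mod dim_row A, k div dim_row A))"

definition matricization ::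
    "nat \<Rightarrow> nat \<Rightarrow> ('a::semiring_0 mat \<Rightarrow> 'a mat) \<Rightarrow> 'a mat" where
  "matricization n q \<L> =
     (THE M. M \<in> carrier_mat (n\<^sup>2) (q\<^sup>2) \<and>
        (\<forall>V\<in>carrier_mat q q. M *\<^sub>v vec_stack V = vec_stack (\<L> V)))"

definition matricization_block ::
    "nat \<Rightarrow> nat \<Rightarrow> ('a::semiring_0 mat \<Rightarrow> 'a mat) \<Rightarrow> nat \<Rightarrow> nat \<Rightarrow> 'a mat" where
  "matricization_block n q \<L> i j =
     mat n q (\<lambda>(a, b). matricization n q \<L> $$ (i * n + a, j * q + b))"

text \<open>
  \<open>lin_dep\<close> speaks about sets, so independence of the family \<open>B 0, \<dots>, B (m - 1)\<close> also
  requires its members to be distinct.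
\<close>

definition indpt_family ::
    "nat \<Rightarrow> nat \<Rightarrow> nat \<Rightarrow> (nat \<Rightarrow> 'a::field mat) \<Rightarrow> bool" where
  "indpt_family n q m B \<longleftrightarrow> inj_on B {..<m} \<and>
     \<not> module.lin_dep class_ring (module_mat TYPE('a) n q) (B ` {..<m})"

text \<open>
  In the following definitions \<open>ik\<close> and \<open>jk\<close> select the blocks \<open>L\<^sub>k\<close>, namely the ones at position
  \<open>(ik k, jk k)\<close> for \<open>k < m\<close>. The vector \<open>block_coeffs n q \<L> m ik jk i j\<close> collects the scalars
  \<open>\<alpha>\<^sub>k\<close> in the expansion of the block at position \<open>(i, j)\<close> in terms of the \<open>L\<^sub>k\<close>.
\<close>

definition block_coeffs ::
    "nat \<Rightarrow> nat \<Rightarrow> ('a::field mat \<Rightarrow> 'a mat) \<Rightarrow> nat \<Rightarrow> (nat \<Rightarrow> nat) \<Rightarrow> (nat \<Rightarrow> nat)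
      \<Rightarrow> nat \<Rightarrow> nat \<Rightarrow> 'a vec" where
  "block_coeffs n q \<L> m ik jk i j =
     (THE \<alpha>. \<alpha> \<in> carrier_vec m \<and>
        matricization_block n q \<L> i j =
          finsum (module_mat TYPE('a) n q)
            (\<lambda>k. \<alpha> $ k \<cdot>\<^sub>m matricization_block n q \<L> (ik k) (jk k)) {..<m})"

definition coeff_mat ::
    "nat \<Rightarrow> nat \<Rightarrow> ('a::conjugatable_field mat \<Rightarrow> 'a mat) \<Rightarrow> nat \<Rightarrow> (nat \<Rightarrow> nat)
      \<Rightarrow> (nat \<Rightarrow> nat) \<Rightarrow> nat \<Rightarrow> 'a mat" where
  "coeff_mat n q \<L> m ik jk k =
     mat n q (\<lambda>(i, j). conjugate (block_coeffs n q \<L> m ik jk i j $ k))"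

definition A_hat ::
    "nat \<Rightarrow> nat \<Rightarrow> ('a::conjugatable_field mat \<Rightarrow> 'a mat) \<Rightarrow> nat \<Rightarrow> (nat \<Rightarrow> nat)
      \<Rightarrow> (nat \<Rightarrow> nat) \<Rightarrow> 'a mat" where
  "A_hat n q \<L> m ik jk =
     mat_adjoint (mat_of_cols (n * q)
       (map (\<lambda>k. vec_stack (coeff_mat n q \<L> m ik jk k)) [0..<m]))"

definition kron_vec :: "'a::times vec \<Rightarrow> 'a vec \<Rightarrow> 'a vec" where
  "kron_vec z x = vec (dim_vec z * dim_vec x) (\<lambda>k. z $ (k div dim_vec x) * x $ (k mod dim_vec x))"

definition kron_image :: "nat \<Rightarrow> nat \<Rightarrow> 'a::semiring_0 mat \<Rightarrow> 'a vec set" where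
  "kron_image n q A = {A *\<^sub>v kron_vec z x | x z. x \<in> carrier_vec n \<and> z \<in> carrier_vec q}"

end

theory Submission
  imports Defs
begin

text \<open>
  Read the Choi matrix as a sesquilinear form \<open>C\<close> on \<open>F\<^sup>q \<otimes> F\<^sup>n\<close>. Its column at \<open>(j, i)\<close> is the block
  \<open>L\<^sub>i\<^sub>j\<close> of the matricization, stacked into a vector, so the selected blocks are \<open>m = rank C\<close>
  independent columns, hence a basis of the column space, and \<open>C = B \<cdot> A\<close> where \<open>B\<close> consists of the
  selected columns and \<open>A\<close> is \<open>A_hat\<close>, whose columns are the coordinate vectors \<open>\<alpha>\<^sup>i\<^sup>j\<close>.

  The image under \<open>A\<close> of product vectors is everything: the coordinate vector of a selected
  block is a unit vector, so \<open>A\<close> sends \<open>\<Sum>\<^sub>k y\<^sub>k (e\<^bsub>j k\<^esub> \<otimes> e\<^bsub>i k\<^esub>)\<close> to \<open>y\<close>, and when all \<open>i\<^sub>k\<close> (or all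
  \<open>j\<^sub>k\<close>) agree, this sum of product vectors is itself a product vector
  (\<open>kron_image_full_if_selection_on_line\<close>).

  For complete positivity, \<open>C\<close> is Hermitian, so expanding its rows as well as its columns gives
  \<open>C = A\<^sup>* H A\<close> (\<open>choi_form_factorization\<close>). Positivity of the map makes \<open>C\<close>
  nonnegative on product vectors, and since these already exhaust the values of \<open>A\<close>, the form \<open>C\<close> is
  nonnegative on all vectors (\<open>nonneg_form_if_factor_exhausted\<close>). A nonnegative Choi form is
  a combination of rank one forms with nonnegative weights (\<open>nonneg_form_decomposition\<close>), and each
  rank one summand contributes a map \<open>V \<mapsto> W V W\<^sup>*\<close>, which is completely positive
  (\<open>nonneg_form_contract\<close>).

  All of this is carried out once, over a field with conjugation whose partial order is compatible
  with products, and then specialised to the complex and the real numbers.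
\<close>

section \<open>Nonnegative Hermitian forms\<close>

lemma conjugate_one: "conjugate (1::'a::conjugatable_field) = 1"
proof -
  have "conjugate (1::'a) * conjugate 1 = conjugate 1"
    using conjugate_dist_mul[of "1::'a" 1] by simp
  then show ?thesis
    using conjugate_zero_iff[of "1::'a"] by (metis mult_cancel_right1 zero_neq_one)
qed

lemma zero_less_one_conjugatable: "(0::'a::conjugatable_ordered_field) < 1"
  using conjugate_square_positive[of "1::'a"] by (simp add: conjugate_one less_le)

lemma conjugate_inverse_field: "conjugate (inverse (x::'a::conjugatable_field)) = inverse (conjugate x)"
proof (cases "x = 0")
  case False
  have "conjugate x * conjugate (inverse x) = 1"
    using False by (simp flip: conjugate_dist_mul add: conjugate_one)
  then show ?thesis by (metis inverse_unique)
qed simp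

lemma conjugate_diff: "conjugate (x - y :: 'a::conjugatable_ring) = conjugate x - conjugate y"
  using conjugate_dist_add[of x "- y"] by (simp add: conjugate_neg)

text \<open>
  The order is partial, so nonnegativity of the inverse comes from \<open>x\<inverse> = x \<cdot> (x\<inverse> \<cdot> x\<inverse>)\<close>, where the
  second factor has the form \<open>y \<cdot> conjugate y\<close>.
\<close>

lemma inverse_nonneg_conjugatable:
  fixes x :: "'a::{conjugatable_ordered_field, ordered_comm_ring}"
  assumes "0 \<le> x" and "conjugate x = x"
  shows "0 \<le> inverse x"
proof -
  have "0 \<le> x * (inverse x * conjugate (inverse x))"
    by (intro mult_nonneg_nonneg assms conjugate_square_positive)
  also have "\<dots> = inverse x"
    using assms(2) by (cases "x = 0") (auto simp: conjugate_inverse_field)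
  finally show ?thesis .
qed

text \<open>
  Forms are indexed by arbitrary types rather than by initial segments of the naturals, so that
  the block structure of a matrix can be expressed by pairs of indices.
\<close>

definition nonneg_form :: "'i set \<Rightarrow> ('i \<Rightarrow> 'i \<Rightarrow> 'a::conjugatable_ordered_field) \<Rightarrow> bool" where
  "nonneg_form I A \<longleftrightarrow> (\<forall>v. 0 \<le> (\<Sum>i\<in>I. \<Sum>j\<in>I. conjugate (v i) * A i j * v j))"

definition hermitian_form :: "'i set \<Rightarrow> ('i \<Rightarrow> 'i \<Rightarrow> 'a::conjugatable_field) \<Rightarrow> bool" where
  "hermitian_form I A \<longleftrightarrow> (\<forall>i\<in>I. \<forall>j\<in>I. A i j = conjugate (A j i))"

lemma nonneg_form_subset:
  fixes A :: "'i \<Rightarrow> 'i \<Rightarrow> 'a::conjugatable_ordered_field"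
  assumes "finite I" "J \<subseteq> I" "nonneg_form I A"
  shows "nonneg_form J A"
  unfolding nonneg_form_def
proof
  fix v :: "'i \<Rightarrow> 'a"
  let ?v = "\<lambda>i. if i \<in> J then v i else 0"
  have "0 \<le> (\<Sum>i\<in>I. \<Sum>j\<in>I. conjugate (?v i) * A i j * ?v j)"
    using assms(3) unfolding nonneg_form_def by (rule spec)
  also have "\<dots> = (\<Sum>i\<in>J. \<Sum>j\<in>I. conjugate (?v i) * A i j * ?v j)"
    using assms by (intro sum.mono_neutral_right) auto
  also have "\<dots> = (\<Sum>i\<in>J. \<Sum>j\<in>J. conjugate (v i) * A i j * v j)"
  proof (rule sum.cong[OF refl])
    fix i assume "i \<in> J"
    have "(\<Sum>j\<in>I. conjugate (?v i) * A i j * ?v j) = (\<Sum>j\<in>J. conjugate (?v i) * A i j * ?v j)"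
      using assms by (intro sum.mono_neutral_right) auto
    then show "(\<Sum>j\<in>I. conjugate (?v i) * A i j * ?v j) = (\<Sum>j\<in>J. conjugate (v i) * A i j * v j)"
      using \<open>i \<in> J\<close> by simp
  qed
  finally show "0 \<le> (\<Sum>i\<in>J. \<Sum>j\<in>J. conjugate (v i) * A i j * v j)" .
qed

lemma nonneg_form_diagonal:
  assumes "finite I" "nonneg_form I A" "i \<in> I"
  shows "0 \<le> A i i"
proof -
  have "nonneg_form {i} A" using nonneg_form_subset[OF assms(1) _ assms(2)] assms(3) by simp
  then have "0 \<le> conjugate 1 * A i i * 1" 
    unfolding nonneg_form_def by (drule_tac x = "\<lambda>_. 1" in spec) simp
  then show ?thesis by (simp add: conjugate_one)
qed

text \<open>
  Restricted to the indices \<open>p\<close> and \<open>i\<close>, and with \<open>v i = 1\<close>, the form contains \<open>A i p \<cdot> v p\<close> and its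
  conjugate but nothing quadratic in \<open>v p\<close>; if \<open>A i p\<close> were nonzero, a suitable \<open>v p\<close> would make the form negative.
\<close>

lemma nonneg_form_zero_diagonal:
  fixes A :: "'i \<Rightarrow> 'i \<Rightarrow> 'a::{conjugatable_ordered_field, ordered_comm_ring}"
  assumes I: "finite I" and A: "nonneg_form I A" and herm: "hermitian_form I A"
    and p: "p \<in> I" "A p p = 0" and i: "i \<in> I"
  shows "A i p = 0"
proof (rule ccontr)
  assume nz: "A i p \<noteq> 0"
  then have ne: "i \<noteq> p" using p by auto
  define c where "c = A i i + 1"
  have real: "conjugate (A i i) = A i i" and sym: "A p i = conjugate (A i p)"
    using herm i p unfolding hermitian_form_def by metis+
  \<comment> \<open>With this entry at \<open>p\<close> each of the two cross terms of the form is \<open>- (A i i + 1)\<close>.\<close>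
  define v where "v = (\<lambda>j. if j = p then - c / A i p else 1)"
  have cross: "A i p * (- c / A i p) = - c"
    using nz by simp
  have "conjugate (- c / A i p) * A p i = conjugate (A i p * (- c / A i p))"
    unfolding conjugate_dist_mul sym by simp
  also have "\<dots> = - c"
    unfolding cross conjugate_neg by (simp add: c_def conjugate_dist_add real conjugate_one)
  finally have cross': "conjugate (- c / A i p) * A p i = - c" .
  have "nonneg_form {p, i} A" using nonneg_form_subset[OF I _ A] p i by simp
  then have "0 \<le> (\<Sum>k\<in>{p, i}. \<Sum>j\<in>{p, i}. conjugate (v k) * A k j * v j)"
    unfolding nonneg_form_def by blast
  also have "\<dots> = conjugate (- c / A i p) * A p i + (A i p * (- c / A i p) + A i i)"
    using ne p by (simp add: v_def conjugate_one)
  also have "\<dots> = - (A i i + 1 + 1)" unfolding cross cross' by (simp add: c_def)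
  finally have "A i i + 1 + 1 \<le> 0" by (metis neg_0_le_iff_le)
  moreover have "0 < A i i + 1 + 1"
    by (rule add_pos_pos[OF add_nonneg_pos[OF nonneg_form_diagonal[OF I A i]
          zero_less_one_conjugatable] zero_less_one_conjugatable])
  ultimately show False by (metis less_le_not_le)
qed

text \<open>
  Completing the square: for given \<open>v\<close> on \<open>I\<close>, the entry \<open>v p\<close> is chosen to minimise the form on
  \<open>insert p I\<close>, and the minimum is the value of the Schur complement at \<open>v\<close>.
\<close>

lemma nonneg_form_schur_complement:
  fixes A :: "'i \<Rightarrow> 'i \<Rightarrow> 'a::{conjugatable_ordered_field, ordered_comm_ring}"
  assumes I: "finite I" and p: "p \<notin> I" "A p p \<noteq> 0"
    and A: "nonneg_form (insert p I) A" and herm: "hermitian_form (insert p I) A"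
  shows "nonneg_form I (\<lambda>i j. A i j - A i p * inverse (A p p) * A p j)"
  unfolding nonneg_form_def
proof
  fix v :: "'i \<Rightarrow> 'a"
  define c where "c = inverse (A p p)"
  define s where "s = (\<Sum>j\<in>I. A p j * v j)"
  define t where "t = (\<Sum>i\<in>I. conjugate (v i) * A i p)"
  have "conjugate (A p p) = A p p" and sym: "\<And>i. i \<in> I \<Longrightarrow> conjugate (A p i) = A i p"
    using herm unfolding hermitian_form_def by (metis insert_iff)+
  then have c: "conjugate c = c" "c * A p p = 1"
    using p(2) by (auto simp: c_def conjugate_inverse_field)
  have t: "t = conjugate s"
    unfolding t_def s_def sum_conjugate[OF I]
    by (intro sum.cong refl) (simp add: conjugate_dist_mul sym)
  define u where "u = v(p := - c * s)"
  have u_p: "u p = - c * s" and u_I: "\<And>i. i \<in> I \<Longrightarrow> u i = v i"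
    using p(1) by (auto simp: u_def)
  have row: "(\<Sum>j\<in>insert p I. conjugate (u i) * A i j * u j) =
      conjugate (u i) * A i p * (- c * s) + (\<Sum>j\<in>I. conjugate (u i) * A i j * v j)" for i
    using I p(1) u_p u_I by simp
  have "0 \<le> (\<Sum>i\<in>insert p I. \<Sum>j\<in>insert p I. conjugate (u i) * A i j * u j)"
    using A unfolding nonneg_form_def by blast
  also have "\<dots> = conjugate (- c * s) * A p p * (- c * s) + (\<Sum>j\<in>I. conjugate (- c * s) * A p j * v j)
      + (\<Sum>i\<in>I. conjugate (u i) * A i p * (- c * s) + (\<Sum>j\<in>I. conjugate (u i) * A i j * v j))"
    unfolding row sum.insert[OF I p(1)] u_p ..
  also have "(\<Sum>i\<in>I. conjugate (u i) * A i p * (- c * s) + (\<Sum>j\<in>I. conjugate (u i) * A i j * v j)) =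
      (\<Sum>i\<in>I. conjugate (v i) * A i p * (- c * s)) + (\<Sum>i\<in>I. \<Sum>j\<in>I. conjugate (v i) * A i j * v j)"
    unfolding sum.distrib[symmetric] by (intro sum.cong refl) (simp add: u_I)
  also have "(\<Sum>j\<in>I. conjugate (- c * s) * A p j * v j) = conjugate (- c * s) * s"
    by (simp add: s_def sum_distrib_left mult.assoc)
  also have "(\<Sum>i\<in>I. conjugate (v i) * A i p * (- c * s)) = t * (- c * s)"
    by (simp add: t_def sum_distrib_right sum_negf)
  also have "conjugate (- c * s) = - c * t"
    by (simp add: conjugate_dist_mul conjugate_neg c t)
  also have "- c * t * A p p * (- c * s) + - c * t * s + (t * (- c * s) + (\<Sum>i\<in>I. \<Sum>j\<in>I. conjugate (v i) * A i j * v j))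
      = (\<Sum>i\<in>I. \<Sum>j\<in>I. conjugate (v i) * A i j * v j) - t * c * s"
  proof -
    have "- c * t * A p p * (- c * s) = (c * A p p) * (t * c * s)" by (simp add: ac_simps)
    then show ?thesis unfolding c by (simp add: algebra_simps)
  qed
  also have "t * c * s = (\<Sum>i\<in>I. \<Sum>j\<in>I. conjugate (v i) * (A i p * c * A p j) * v j)"
    unfolding t_def s_def sum_distrib_left sum_distrib_right by (subst sum.swap) (simp add: mult.assoc)
  also have "(\<Sum>i\<in>I. \<Sum>j\<in>I. conjugate (v i) * A i j * v j) - \<dots> =
     (\<Sum>i\<in>I. \<Sum>j\<in>I. conjugate (v i) * (A i j - A i p * c * A p j) * v j)"
    by (simp add: sum_subtractf algebra_simps)
  finally show "0 \<le> (\<Sum>i\<in>I. \<Sum>j\<in>I. conjugate (v i) * (A i j - A i p * inverse (A p p) * A p j) * v j)"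
    unfolding c_def .
qed

text \<open>
  This is the factorization \<open>A = W D W\<^sup>*\<close> with a nonnegative diagonal \<open>D\<close>, obtained by Gaussian
  elimination: the pivot \<open>p\<close> splits off the rank one form \<open>A i p \<cdot> A p j / A p p\<close>, and the remainder is
  the Schur complement. If the pivot vanishes, then so do its row and column; the convention
  \<open>inverse 0 = 0\<close> lets both cases share one formula. The weights stay separate from the
  vectors because the field may lack square roots.
\<close>

theorem nonneg_form_decomposition:
  fixes A :: "'i \<Rightarrow> 'i \<Rightarrow> 'a::{conjugatable_ordered_field, ordered_comm_ring}"
  assumes "finite I" "nonneg_form I A" "hermitian_form I A"
  shows "\<exists>d w. (\<forall>k\<in>I. 0 \<le> d k) \<and>
    (\<forall>i\<in>I. \<forall>j\<in>I. A i j = (\<Sum>k\<in>I. d k * (w k i * conjugate (w k j))))"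
  using assms
proof (induction I arbitrary: A rule: finite_induct)
  case (insert p I)
  define c where "c = inverse (A p p)"
  have fin: "finite (insert p I)" using insert.hyps by simp
  have herm: "\<And>i j. i \<in> insert p I \<Longrightarrow> j \<in> insert p I \<Longrightarrow> A i j = conjugate (A j i)"
    using insert.prems(2) unfolding hermitian_form_def by metis
  have pp: "0 \<le> A p p" "conjugate (A p p) = A p p"
    using nonneg_form_diagonal[OF fin insert.prems(1)] herm[of p p] by auto
  then have c: "0 \<le> c" "conjugate c = c"
    by (auto simp: c_def inverse_nonneg_conjugatable conjugate_inverse_field)
  define A' where "A' = (\<lambda>i j. A i j - A i p * c * A p j)"
  have col: "A i p * c * A p p = A i p" if "i \<in> insert p I" for i
    using nonneg_form_zero_diagonal[OF fin insert.prems(1,2) _ _ that, of p]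
    by (cases "A p p = 0") (auto simp: c_def)
  have "nonneg_form I A'"
  proof (cases "A p p = 0")
    case True
    then show ?thesis
      using nonneg_form_subset[OF fin _ insert.prems(1), of I] by (auto simp: A'_def c_def)
  next
    case False
    show ?thesis unfolding A'_def c_def
      using nonneg_form_schur_complement[OF insert.hyps False insert.prems] .
  qed
  moreover have "hermitian_form I A'"
    unfolding hermitian_form_def
  proof (intro ballI)
    fix i j assume "i \<in> I" "j \<in> I"
    then have "A i j = conjugate (A j i)" "A i p = conjugate (A p i)" "A p j = conjugate (A j p)"
      by (simp_all add: herm[symmetric])
    then show "A' i j = conjugate (A' j i)"
      unfolding A'_def conjugate_diff conjugate_dist_mul c by (simp only: ac_simps)
  qed
  ultimately obtain d w where d: "\<forall>k\<in>I. 0 \<le> d k"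
    and w: "\<forall>i\<in>I. \<forall>j\<in>I. A' i j = (\<Sum>k\<in>I. d k * (w k i * conjugate (w k j)))"
    using insert.IH by blast
  \<comment> \<open>The pivot contributes its column; the vectors of the remainder are extended by \<open>0\<close> at \<open>p\<close>.\<close>
  let ?d = "d(p := c)"
  let ?w = "\<lambda>k i. if k = p then A i p else if i = p then 0 else w k i"
  have "A i j = (\<Sum>k\<in>insert p I. ?d k * (?w k i * conjugate (?w k j)))"
    if ij: "i \<in> insert p I" "j \<in> insert p I" for i j
  proof -
    have row: "A p j = conjugate (A j p)" using herm ij by blast
    have "(\<Sum>k\<in>insert p I. ?d k * (?w k i * conjugate (?w k j))) =
        A i p * c * A p j + (\<Sum>k\<in>I. ?d k * (?w k i * conjugate (?w k j)))"
      using insert.hyps by (simp add: row ac_simps)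
    also have "(\<Sum>k\<in>I. ?d k * (?w k i * conjugate (?w k j))) =
        (if i = p \<or> j = p then 0 else (\<Sum>k\<in>I. d k * (w k i * conjugate (w k j))))"
      using insert.hyps by (auto intro!: sum.neutral sum.cong)
    also have "\<dots> = A i j - A i p * c * A p j"
    proof (cases "i = p \<or> j = p")
      case True
      have "A p p * c * A p j = conjugate (A j p * c * A p p)"
        by (simp add: conjugate_dist_mul c pp row ac_simps)
      also have "\<dots> = A p j"
        unfolding col[OF ij(2)] row ..
      finally have "A i p * c * A p j = A i j"
        using True col[OF ij(1)] by blast
      then show ?thesis using True by (simp only: if_True diff_self)
    next
      case False
      then have "i \<in> I" "j \<in> I" using ij by auto
      then have "(\<Sum>k\<in>I. d k * (w k i * conjugate (w k j))) = A' i j"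
        using w by (intro sym[of "A' i j"]) blast
      then show ?thesis using False by (simp only: if_False A'_def)
    qed
    finally show ?thesis by simp
  qed
  moreover have "0 \<le> ?d k" if "k \<in> insert p I" for k using that c d by auto
  ultimately show ?case
    by (intro exI[of _ ?d] exI[of _ ?w] conjI ballI) blast+
qed simp

section \<open>Congruence and contraction of forms\<close>

lemma sum_swap_pairs:
  "(\<Sum>i\<in>I. \<Sum>j\<in>J. \<Sum>p\<in>P. \<Sum>r\<in>R. f i j p r) = (\<Sum>p\<in>P. \<Sum>r\<in>R. \<Sum>i\<in>I. \<Sum>j\<in>J. f i j p r)"
proof -
  have "(\<Sum>i\<in>I. \<Sum>j\<in>J. \<Sum>p\<in>P. \<Sum>r\<in>R. f i j p r) =
      (\<Sum>x\<in>I \<times> J. \<Sum>y\<in>P \<times> R. f (fst x) (snd x) (fst y) (snd y))"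
    by (simp add: sum.cartesian_product')
  also have "\<dots> = (\<Sum>y\<in>P \<times> R. \<Sum>x\<in>I \<times> J. f (fst x) (snd x) (fst y) (snd y))"
    by (rule sum.swap)
  finally show ?thesis by (simp add: sum.cartesian_product')
qed

lemma form_congruence:
  fixes V :: "'j \<Rightarrow> 'j \<Rightarrow> 'a::conjugatable_field" and M :: "'j \<Rightarrow> 'i \<Rightarrow> 'a"
  assumes "finite I" "finite J"
  shows "(\<Sum>i\<in>I. \<Sum>j\<in>I. conjugate (u i) * (\<Sum>p\<in>J. \<Sum>r\<in>J. conjugate (M p i) * V p r * M r j) * u j) =
    (\<Sum>p\<in>J. \<Sum>r\<in>J. conjugate (\<Sum>i\<in>I. M p i * u i) * V p r * (\<Sum>i\<in>I. M r i * u i))"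
proof -
  have "(\<Sum>i\<in>I. \<Sum>j\<in>I. conjugate (u i) * (\<Sum>p\<in>J. \<Sum>r\<in>J. conjugate (M p i) * V p r * M r j) * u j) =
      (\<Sum>i\<in>I. \<Sum>j\<in>I. \<Sum>p\<in>J. \<Sum>r\<in>J. conjugate (M p i * u i) * V p r * (M r j * u j))"
    by (simp add: sum_distrib_left sum_distrib_right conjugate_dist_mul ac_simps)
  also have "\<dots> = (\<Sum>p\<in>J. \<Sum>r\<in>J. \<Sum>i\<in>I. \<Sum>j\<in>I. conjugate (M p i * u i) * V p r * (M r j * u j))"
    by (rule sum_swap_pairs)
  also have "\<dots> = (\<Sum>p\<in>J. \<Sum>r\<in>J. conjugate (\<Sum>i\<in>I. M p i * u i) * V p r * (\<Sum>i\<in>I. M r i * u i))"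
  proof (intro sum.cong refl)
    fix p r
    have "(\<Sum>i\<in>I. \<Sum>j\<in>I. conjugate (M p i * u i) * V p r * (M r j * u j)) =
        (\<Sum>i\<in>I. conjugate (M p i * u i) * V p r) * (\<Sum>j\<in>I. M r j * u j)"
      by (rule sum_product[symmetric])
    also have "(\<Sum>i\<in>I. conjugate (M p i * u i) * V p r) = conjugate (\<Sum>i\<in>I. M p i * u i) * V p r"
      by (simp only: sum_conjugate[OF assms(1)] sum_distrib_right)
    finally show "(\<Sum>i\<in>I. \<Sum>j\<in>I. conjugate (M p i * u i) * V p r * (M r j * u j)) =
        conjugate (\<Sum>i\<in>I. M p i * u i) * V p r * (\<Sum>i\<in>I. M r i * u i)" .
  qed
  finally show ?thesis .
qed

lemma nonneg_form_congruence:
  fixes V :: "'j \<Rightarrow> 'j \<Rightarrow> 'a::conjugatable_ordered_field" and M :: "'j \<Rightarrow> 'i \<Rightarrow> 'a"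
  assumes "finite I" "finite J" "nonneg_form J V"
  shows "nonneg_form I (\<lambda>i j. \<Sum>p\<in>J. \<Sum>r\<in>J. conjugate (M p i) * V p r * M r j)"
  unfolding nonneg_form_def form_congruence[OF assms(1,2)]
  by (rule allI, rule assms(3)[unfolded nonneg_form_def, THEN spec])

lemma nonneg_form_cong:
  assumes "\<And>i j. i \<in> I \<Longrightarrow> j \<in> I \<Longrightarrow> A i j = B i j"
  shows "nonneg_form I A \<longleftrightarrow> nonneg_form I B"
  using assms unfolding nonneg_form_def by (simp cong: sum.cong)

lemma nonneg_form_sum:
  fixes A :: "'k \<Rightarrow> 'i \<Rightarrow> 'i \<Rightarrow> 'a::{conjugatable_ordered_field, ordered_comm_ring}"
  assumes "\<And>k. k \<in> S \<Longrightarrow> 0 \<le> g k" "\<And>k. k \<in> S \<Longrightarrow> nonneg_form I (A k)"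
  shows "nonneg_form I (\<lambda>i j. \<Sum>k\<in>S. g k * A k i j)"
  unfolding nonneg_form_def
proof
  fix v :: "'i \<Rightarrow> 'a"
  have "(\<Sum>i\<in>I. \<Sum>j\<in>I. conjugate (v i) * (\<Sum>k\<in>S. g k * A k i j) * v j) =
      (\<Sum>i\<in>I. \<Sum>k\<in>S. \<Sum>j\<in>I. g k * (conjugate (v i) * A k i j * v j))"
    unfolding sum_distrib_left sum_distrib_right
    by (subst (2) sum.swap) (simp add: ac_simps)
  also have "\<dots> = (\<Sum>k\<in>S. g k * (\<Sum>i\<in>I. \<Sum>j\<in>I. conjugate (v i) * A k i j * v j))"
    unfolding sum_distrib_left by (rule sum.swap)
  also have "0 \<le> \<dots>"
  proof (rule sum_nonneg)
    fix k assume "k \<in> S"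
    then show "0 \<le> g k * (\<Sum>i\<in>I. \<Sum>j\<in>I. conjugate (v i) * A k i j * v j)"
      by (intro mult_nonneg_nonneg assms(1) assms(2)[unfolded nonneg_form_def, THEN spec])
  qed
  finally show "0 \<le> (\<Sum>i\<in>I. \<Sum>j\<in>I. conjugate (v i) * (\<Sum>k\<in>S. g k * A k i j) * v j)" .
qed

lemma sum_Times_delta:
  fixes f :: "'p \<times> 'c \<Rightarrow> 'a::comm_semiring_0"
  assumes "finite P" "a \<in> P"
  shows "(\<Sum>p\<in>P \<times> Q. if fst p = a then f p else 0) = (\<Sum>c\<in>Q. f (a, c))"
proof -
  have "(\<Sum>p\<in>P \<times> Q. if fst p = a then f p else 0) = (\<Sum>b\<in>P. if b = a then (\<Sum>c\<in>Q. f (b, c)) else 0)"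
    unfolding sum.cartesian_product' by (intro sum.cong refl) simp
  then show ?thesis using assms by (simp add: sum.delta)
qed

text \<open>
  For \<open>K = w w\<^sup>*\<close> the contracted form is the congruence transform of \<open>V\<close> by the matrix \<open>M\<close> that
  is the identity in the first index and, in the second, the entrywise conjugate of \<open>w\<close> read as
  a matrix. The general case follows by decomposing \<open>K\<close> into nonnegative multiples of such forms.
\<close>

lemma nonneg_form_contract:
  fixes V :: "'p \<times> 'c \<Rightarrow> 'p \<times> 'c \<Rightarrow> 'a::{conjugatable_ordered_field, ordered_comm_ring}"
    and K :: "'c \<times> 's \<Rightarrow> 'c \<times> 's \<Rightarrow> 'a"
  assumes fin: "finite P" "finite Q" "finite N"
    and V: "nonneg_form (P \<times> Q) V"
    and K: "nonneg_form (Q \<times> N) K" "hermitian_form (Q \<times> N) K"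
  shows "nonneg_form (P \<times> N)
    (\<lambda>x y. \<Sum>c\<in>Q. \<Sum>d\<in>Q. V (fst x, c) (fst y, d) * K (c, snd x) (d, snd y))"
proof -
  obtain g w where g: "\<forall>k\<in>Q \<times> N. 0 \<le> g k"
    and w: "\<forall>i\<in>Q \<times> N. \<forall>j\<in>Q \<times> N. K i j = (\<Sum>k\<in>Q \<times> N. g k * (w k i * conjugate (w k j)))"
    using nonneg_form_decomposition[OF _ K] fin by auto
  define M where "M = (\<lambda>k p (x :: 'p \<times> 's). if fst p = fst x then conjugate (w k (snd p, snd x)) else 0)"
  have "nonneg_form (P \<times> N) (\<lambda>x y. \<Sum>k\<in>Q \<times> N. g k *
      (\<Sum>p\<in>P \<times> Q. \<Sum>r\<in>P \<times> Q. conjugate (M k p x) * V p r * M k r y))"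
    using g fin V by (intro nonneg_form_sum nonneg_form_congruence) auto
  moreover have "(\<Sum>k\<in>Q \<times> N. g k * (\<Sum>p\<in>P \<times> Q. \<Sum>r\<in>P \<times> Q. conjugate (M k p x) * V p r * M k r y)) =
      (\<Sum>c\<in>Q. \<Sum>d\<in>Q. V (fst x, c) (fst y, d) * K (c, snd x) (d, snd y))"
    if x: "x \<in> P \<times> N" and y: "y \<in> P \<times> N" for x y
  proof -
    have inner: "(\<Sum>p\<in>P \<times> Q. \<Sum>r\<in>P \<times> Q. conjugate (M k p x) * V p r * M k r y) =
        (\<Sum>c\<in>Q. \<Sum>d\<in>Q. V (fst x, c) (fst y, d) * (w k (c, snd x) * conjugate (w k (d, snd y))))" for k
    proof -
      have "(\<Sum>p\<in>P \<times> Q. \<Sum>r\<in>P \<times> Q. conjugate (M k p x) * V p r * M k r y) =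
        (\<Sum>p\<in>P \<times> Q. if fst p = fst x then (\<Sum>r\<in>P \<times> Q. if fst r = fst y
           then V p r * (w k (snd p, snd x) * conjugate (w k (snd r, snd y))) else 0) else 0)"
        by (intro sum.cong refl) (auto simp: M_def ac_simps intro!: sum.cong)
      also have "\<dots> = (\<Sum>c\<in>Q. \<Sum>d\<in>Q. V (fst x, c) (fst y, d) * (w k (c, snd x) * conjugate (w k (d, snd y))))"
        using x y fin by (simp add: sum_Times_delta mem_Times_iff)
      finally show ?thesis .
    qed
    have "(\<Sum>k\<in>Q \<times> N. g k * (\<Sum>p\<in>P \<times> Q. \<Sum>r\<in>P \<times> Q. conjugate (M k p x) * V p r * M k r y)) =
       (\<Sum>k\<in>Q \<times> N. \<Sum>c\<in>Q. \<Sum>d\<in>Q. V (fst x, c) (fst y, d) * (g k * (w k (c, snd x) * conjugate (w k (d, snd y)))))"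
      unfolding inner by (simp add: sum_distrib_left ac_simps)
    also have "\<dots> = (\<Sum>c\<in>Q. \<Sum>d\<in>Q. \<Sum>k\<in>Q \<times> N. V (fst x, c) (fst y, d) * (g k * (w k (c, snd x) * conjugate (w k (d, snd y)))))"
      by (subst sum.swap, rule sum.cong[OF refl], rule sum.swap)
    also have "\<dots> = (\<Sum>c\<in>Q. \<Sum>d\<in>Q. V (fst x, c) (fst y, d) * K (c, snd x) (d, snd y))"
      using w x y by (intro sum.cong refl) (auto simp: sum_distrib_left)
    finally show ?thesis .
  qed
  ultimately show ?thesis by (rule nonneg_form_cong[THEN iffD1, rotated])
qed

text \<open>
  If \<open>K = \<alpha>\<^sup>* H \<alpha>\<close>, then the value of \<open>K\<close> at \<open>v\<close> depends on \<open>\<alpha> v\<close> only. Nonnegativity therefore has to be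
  tested only on a set \<open>W\<close> of vectors whose images under \<open>\<alpha>\<close> are all the vectors there are.
\<close>

lemma nonneg_form_if_factor_exhausted:
  fixes H :: "'k \<Rightarrow> 'k \<Rightarrow> 'a::conjugatable_ordered_field" and \<alpha> :: "'k \<Rightarrow> 'i \<Rightarrow> 'a"
  assumes fin: "finite I" "finite M"
    and K: "\<And>i j. i \<in> I \<Longrightarrow> j \<in> I \<Longrightarrow>
      K i j = (\<Sum>k\<in>M. \<Sum>l\<in>M. conjugate (\<alpha> k i) * H k l * \<alpha> l j)"
    and pos: "\<And>w. w \<in> W \<Longrightarrow> 0 \<le> (\<Sum>i\<in>I. \<Sum>j\<in>I. conjugate (w i) * K i j * w j)"
    and surj: "\<And>y. \<exists>w\<in>W. \<forall>k\<in>M. (\<Sum>i\<in>I. \<alpha> k i * w i) = y k"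
  shows "nonneg_form I K"
  unfolding nonneg_form_def
proof
  fix v :: "'i \<Rightarrow> 'a"
  have form: "(\<Sum>i\<in>I. \<Sum>j\<in>I. conjugate (u i) * K i j * u j) =
      (\<Sum>k\<in>M. \<Sum>l\<in>M. conjugate (\<Sum>i\<in>I. \<alpha> k i * u i) * H k l * (\<Sum>i\<in>I. \<alpha> l i * u i))" for u
    unfolding form_congruence[OF fin, symmetric] by (intro sum.cong refl) (simp add: K)
  obtain w where w: "w \<in> W" "\<forall>k\<in>M. (\<Sum>i\<in>I. \<alpha> k i * w i) = (\<Sum>i\<in>I. \<alpha> k i * v i)"
    using surj[of "\<lambda>k. \<Sum>i\<in>I. \<alpha> k i * v i"] by blast
  have "(\<Sum>i\<in>I. \<Sum>j\<in>I. conjugate (v i) * K i j * v j) = (\<Sum>i\<in>I. \<Sum>j\<in>I. conjugate (w i) * K i j * w j)"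
    unfolding form using w(2) by (simp cong: sum.cong)
  then show "0 \<le> (\<Sum>i\<in>I. \<Sum>j\<in>I. conjugate (v i) * K i j * v j)"
    using pos[OF w(1)] by simp
qed

section \<open>Positive semidefinite matrices and block indices\<close>

lemma pair_index_less: "i < k \<Longrightarrow> a < n \<Longrightarrow> i * n + a < k * (n::nat)"
proof -
  assume "i < k" "a < n"
  then have "i * n + a < Suc i * n" "Suc i * n \<le> k * n"
    using mult_le_mono1[of "Suc i" k n] by simp_all
  then show ?thesis by (rule less_le_trans)
qed

lemma bij_betw_pair_index:
  "bij_betw (\<lambda>x. fst x * n + snd x) ({..<k} \<times> {..<n}) {..<k * (n::nat)}"
proof (rule bij_betw_byWitness[where f' = "\<lambda>r. (r div n, r mod n)"])
  show "(\<lambda>r. (r div n, r mod n)) ` {..<k * n} \<subseteq> {..<k} \<times> {..<n}"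
    by (cases "n = 0") (auto simp: less_mult_imp_div_less)
qed (auto intro: pair_index_less)

lemma sum_pair_index:
  fixes f :: "nat \<Rightarrow> 'a::comm_monoid_add"
  shows "(\<Sum>r<k * n. f r) = (\<Sum>i<k. \<Sum>a<n. f (i * n + a))"
  using sum.reindex_bij_betw[OF bij_betw_pair_index, where g = f]
  by (simp add: sum.cartesian_product')

lemma nonneg_form_reindex:
  fixes A :: "'j \<Rightarrow> 'j \<Rightarrow> 'a::conjugatable_ordered_field"
  assumes "bij_betw f I J"
  shows "nonneg_form J A \<longleftrightarrow> nonneg_form I (\<lambda>i j. A (f i) (f j))"
proof
  assume "nonneg_form I (\<lambda>i j. A (f i) (f j))"
  then have "0 \<le> (\<Sum>i\<in>I. \<Sum>j\<in>I. conjugate (v (f i)) * A (f i) (f j) * v (f j))" for v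
    unfolding nonneg_form_def by (rule spec[of _ "\<lambda>i. v (f i)"])
  then show "nonneg_form J A"
    unfolding nonneg_form_def sum.reindex_bij_betw[OF assms, symmetric] by (rule allI)
next
  assume J: "nonneg_form J A"
  show "nonneg_form I (\<lambda>i j. A (f i) (f j))"
    unfolding nonneg_form_def
  proof
    fix v :: "_ \<Rightarrow> 'a"
    define u where "u = (\<lambda>j. v (inv_into I f j))"
    have u: "u (f i) = v i" if "i \<in> I" for i
      using that assms by (simp add: u_def bij_betw_inv_into_left)
    have "0 \<le> (\<Sum>i\<in>J. \<Sum>j\<in>J. conjugate (u i) * A i j * u j)"
      using J unfolding nonneg_form_def by (rule spec)
    then show "0 \<le> (\<Sum>i\<in>I. \<Sum>j\<in>I. conjugate (v i) * A (f i) (f j) * v j)"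
      unfolding sum.reindex_bij_betw[OF assms, symmetric] by (simp add: u cong: sum.cong)
  qed
qed

lemma hermitian_form_reindex:
  assumes "bij_betw f I J"
  shows "hermitian_form J A \<longleftrightarrow> hermitian_form I (\<lambda>i j. A (f i) (f j))"
  unfolding hermitian_form_def bij_betw_imp_surj_on[OF assms, symmetric] by simp

lemma hermitian_form_cong:
  assumes "\<And>i j. i \<in> I \<Longrightarrow> j \<in> I \<Longrightarrow> A i j = B i j"
  shows "hermitian_form I A \<longleftrightarrow> hermitian_form I B"
  using assms unfolding hermitian_form_def by auto

lemma index_mat_adjoint:
  "i < dim_col A \<Longrightarrow> j < dim_row A \<Longrightarrow> mat_adjoint A $$ (i, j) = conjugate (A $$ (j, i))"
  by (simp add: mat_adjoint_def mat_of_rows_def)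

lemma mat_adjoint_carrier: "A \<in> carrier_mat n m \<Longrightarrow> mat_adjoint A \<in> carrier_mat m n"
  by (auto simp: mat_adjoint_def)

lemma psd_mat_iff:
  "psd_mat n A \<longleftrightarrow> A \<in> carrier_mat n n \<and> hermitian_form {..<n} (\<lambda>i j. A $$ (i, j)) \<and>
     nonneg_form {..<n} (\<lambda>i j. A $$ (i, j))"
proof (cases "A \<in> carrier_mat n n")
  case True
  have "mat_adjoint A = A \<longleftrightarrow> hermitian_form {..<n} (\<lambda>i j. A $$ (i, j))"
  proof
    assume "mat_adjoint A = A"
    then show "hermitian_form {..<n} (\<lambda>i j. A $$ (i, j))"
      unfolding hermitian_form_def
      by (metis True carrier_matD index_mat_adjoint lessThan_iff)
  next
    assume herm: "hermitian_form {..<n} (\<lambda>i j. A $$ (i, j))"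
    show "mat_adjoint A = A"
    proof (rule eq_matI)
      fix i j assume "i < dim_row A" "j < dim_col A"
      then have ij: "i < n" "j < n" using True by auto
      then have "mat_adjoint A $$ (i, j) = conjugate (A $$ (j, i))"
        using True by (simp add: index_mat_adjoint)
      also have "\<dots> = A $$ (i, j)"
        using herm ij unfolding hermitian_form_def by (metis lessThan_iff)
      finally show "mat_adjoint A $$ (i, j) = A $$ (i, j)" .
    qed (use True mat_adjoint_carrier[OF True] in auto)
  qed
  moreover have form: "(A *\<^sub>v v) \<bullet>c v = (\<Sum>i<n. \<Sum>j<n. conjugate (v $ i) * A $$ (i, j) * v $ j)"
    if "v \<in> carrier_vec n" for v
    using True that
    by (auto simp: scalar_prod_def sum_distrib_left sum_distrib_right lessThan_atLeast0 ac_simps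
        intro!: sum.cong)
  have "(\<forall>v\<in>carrier_vec n. 0 \<le> (A *\<^sub>v v) \<bullet>c v) \<longleftrightarrow> nonneg_form {..<n} (\<lambda>i j. A $$ (i, j))"
  proof
    assume *: "\<forall>v\<in>carrier_vec n. 0 \<le> (A *\<^sub>v v) \<bullet>c v"
    show "nonneg_form {..<n} (\<lambda>i j. A $$ (i, j))"
      unfolding nonneg_form_def
    proof
      fix v
      show "0 \<le> (\<Sum>i<n. \<Sum>j<n. conjugate (v i) * A $$ (i, j) * v j)"
        using *[rule_format, of "vec n v"] by (simp add: form)
    qed
  next
    assume *: "nonneg_form {..<n} (\<lambda>i j. A $$ (i, j))"
    show "\<forall>v\<in>carrier_vec n. 0 \<le> (A *\<^sub>v v) \<bullet>c v"
      using *[unfolded nonneg_form_def, THEN spec] by (simp add: form)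
  qed
  ultimately show ?thesis
    using True unfolding psd_mat_def by blast
qed (auto simp: psd_mat_def)

lemma psd_block_mat_iff:
  fixes B :: "nat \<Rightarrow> nat \<Rightarrow> 'a::conjugatable_ordered_field mat"
  defines "F \<equiv> \<lambda>x y. B (fst x) (fst y) $$ (snd x, snd y)"
  shows "psd_mat (k * n) (block_mat k n B) \<longleftrightarrow>
     hermitian_form ({..<k} \<times> {..<n}) F \<and> nonneg_form ({..<k} \<times> {..<n}) F"
proof -
  have entry: "block_mat k n B $$ (fst x * n + snd x, fst y * n + snd y) = F x y"
    if "x \<in> {..<k} \<times> {..<n}" "y \<in> {..<k} \<times> {..<n}" for x y
    using that by (auto simp: block_mat_def F_def pair_index_less)
  have "block_mat k n B \<in> carrier_mat (k * n) (k * n)"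
    by (simp add: block_mat_def)
  moreover have "nonneg_form {..<k * n} (\<lambda>r s. block_mat k n B $$ (r, s)) \<longleftrightarrow>
      nonneg_form ({..<k} \<times> {..<n}) F"
    unfolding nonneg_form_reindex[OF bij_betw_pair_index] by (rule nonneg_form_cong) (rule entry)
  moreover have "hermitian_form {..<k * n} (\<lambda>r s. block_mat k n B $$ (r, s)) \<longleftrightarrow>
      hermitian_form ({..<k} \<times> {..<n}) F"
    unfolding hermitian_form_reindex[OF bij_betw_pair_index]
    by (rule hermitian_form_cong) (rule entry)
  ultimately show ?thesis unfolding psd_mat_iff by blast
qed

section \<open>Independent families and the column space\<close>

lemma finsum_module_mat:
  fixes f :: "'i \<Rightarrow> 'a::comm_ring_1 mat"
  assumes "finite S" "\<And>k. k \<in> S \<Longrightarrow> f k \<in> carrier_mat n q"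
  shows "finsum (module_mat TYPE('a) n q) f S = mat n q (\<lambda>p. \<Sum>k\<in>S. f k $$ p)"
proof -
  interpret abelian_group "module_mat TYPE('a) n q" by (rule abelian_group_mat)
  show ?thesis
    using assms
  proof (induction S rule: finite_induct)
    case empty
    then show ?case by (auto simp: module_mat_simps)
  next
    case (insert k S)
    then have "f \<in> S \<rightarrow> carrier (module_mat TYPE('a) n q)" "f k \<in> carrier (module_mat TYPE('a) n q)"
      by (auto simp: module_mat_simps)
    then have "finsum (module_mat TYPE('a) n q) f (insert k S) =
        f k + finsum (module_mat TYPE('a) n q) f S"
      using insert.hyps by (simp add: finsum_insert module_mat_simps)
    also have "\<dots> = mat n q (\<lambda>p. \<Sum>k\<in>insert k S. f k $$ p)"
      using insert by (auto intro!: eq_matI)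
    finally show ?case .
  qed
qed

lemma indpt_familyD:
  fixes B :: "nat \<Rightarrow> 'a::field mat"
  assumes ind: "indpt_family n q m B" and B: "\<And>k. k < m \<Longrightarrow> B k \<in> carrier_mat n q"
    and zero: "\<And>a b. a < n \<Longrightarrow> b < q \<Longrightarrow> (\<Sum>k<m. c k * B k $$ (a, b)) = 0"
    and "k < m"
  shows "c k = 0"
proof (rule ccontr)
  assume ck: "c k \<noteq> 0"
  interpret vectorspace class_ring "module_mat TYPE('a) n q" by (rule matrix_vs)
  have inj: "inj_on B {..<m}" and indpt: "\<not> lin_dep (B ` {..<m})"
    using ind unfolding indpt_family_def by auto
  define a where "a = (\<lambda>M. c (inv_into {..<m} B M))"
  have a: "a (B k) = c k" if "k < m" for k
    using inj that by (simp add: a_def)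
  have "lincomb a (B ` {..<m}) = mat n q (\<lambda>p. \<Sum>M\<in>B ` {..<m}. (a M \<cdot>\<^sub>m M) $$ p)"
    unfolding lincomb_def matrix_vs_simps
    by (rule finsum_module_mat) (auto simp: B)
  also have "\<dots> = 0\<^sub>m n q"
  proof (intro eq_matI)
    fix i j assume "i < dim_row (0\<^sub>m n q :: 'a mat)" "j < dim_col (0\<^sub>m n q :: 'a mat)"
    then have ij: "i < n" "j < q" by auto
    have "(\<Sum>M\<in>B ` {..<m}. (a M \<cdot>\<^sub>m M) $$ (i, j)) = (\<Sum>k<m. (a (B k) \<cdot>\<^sub>m B k) $$ (i, j))"
      by (rule sum.reindex_cong[OF inj refl]) simp
    also have "\<dots> = (\<Sum>k<m. c k * B k $$ (i, j))"
    proof (rule sum.cong[OF refl])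
      fix k assume "k \<in> {..<m}"
      then show "(a (B k) \<cdot>\<^sub>m B k) $$ (i, j) = c k * B k $$ (i, j)"
        using B[of k] ij by (simp add: a)
    qed
    also have "\<dots> = 0" using zero[OF ij] .
    finally show "mat n q (\<lambda>p. \<Sum>M\<in>B ` {..<m}. (a M \<cdot>\<^sub>m M) $$ p) $$ (i, j) = 0\<^sub>m n q $$ (i, j)"
      using ij by simp
  qed auto
  finally have "lin_dep (B ` {..<m})"
    using \<open>k < m\<close> a ck
    by (intro lin_dep_crit[of "B ` {..<m}" _ a "B k"]) (auto simp: matrix_vs_simps)
  then show False using indpt by blast
qed

text \<open>
  A family of independent columns that is as large as the rank spans the column space: a column
  outside its span could be added without losing independence, and the rank would be larger.
  Independence is stated for the indexed family, which forces the chosen columns to be distinct.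
\<close>

lemma column_expansion:
  fixes A :: "'a::field mat"
  assumes A: "A \<in> carrier_mat N nc" and rank: "vec_space.rank N A = m"
    and s: "\<And>k. k < m \<Longrightarrow> s k < nc" and t: "t < nc"
    and indep: "\<And>c k. (\<And>r. r < N \<Longrightarrow> (\<Sum>k<m. c k * A $$ (r, s k)) = 0) \<Longrightarrow> k < m \<Longrightarrow> c k = 0"
  shows "\<exists>c. \<forall>r<N. A $$ (r, t) = (\<Sum>k<m. c k * A $$ (r, s k))"
proof -
  interpret vec_space "TYPE('a)" N .
  define f where "f = (\<lambda>k. col A (s k))"
  have f_index: "f k $ r = A $$ (r, s k)" if "k < m" "r < N" for k r
    using A s that by (simp add: f_def)
  have inj: "inj_on f {..<m}"
  proof (rule inj_onI, rule ccontr)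
    fix k l assume kl: "k \<in> {..<m}" "l \<in> {..<m}" "f k = f l" "k \<noteq> l"
    define c :: "nat \<Rightarrow> 'a" where "c = (\<lambda>x. if x = k then 1 else if x = l then - 1 else 0)"
    have "(\<Sum>x<m. c x * A $$ (r, s x)) = 0" if "r < N" for r
    proof -
      have "(\<Sum>x<m. c x * A $$ (r, s x)) =
          (\<Sum>x<m. (if x = k then A $$ (r, s x) else 0) - (if x = l then A $$ (r, s x) else 0))"
        using kl(4) by (intro sum.cong) (auto simp: c_def)
      also have "\<dots> = A $$ (r, s k) - A $$ (r, s l)"
        using kl by (simp add: sum_subtractf)
      also have "\<dots> = 0"
        using f_index[of k r] f_index[of l r] kl that by simp
      finally show ?thesis .
    qed
    then have "c k = 0" using indep kl(1) by blast
    then have False by (simp add: c_def)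
    then show False by simp
  qed
  let ?S = "f ` {..<m}"
  have S: "finite ?S" "?S \<subseteq> carrier_vec N" "?S \<subseteq> set (cols A)"
    using A s by (auto simp: f_def cols_def)
  have lincomb: "lincomb a ?S $ r = (\<Sum>k<m. a (f k) * A $$ (r, s k))" if "r < N" for a r
    unfolding lincomb_index[OF that S(2)]
    using that by (subst sum.reindex[OF inj]) (auto simp: f_index intro!: sum.cong)
  have indpt: "lin_indpt ?S"
  proof
    assume "lin_dep ?S"
    then obtain a v where a: "lincomb a ?S = 0\<^sub>v N" "v \<in> ?S" "a v \<noteq> 0"
      using finite_lin_dep[OF S(1) _ S(2)] by (auto simp: class_ring_simps)
    have "a (f k) = 0" if "k < m" for k
      by (rule indep[of "\<lambda>k. a (f k)"]) (use that lincomb[of _ a] a(1) in auto)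
    then show False using a by auto
  qed
  have col_t: "col A t \<in> carrier_vec N" "col A t \<in> set (cols A)"
    using A t by (auto simp: cols_def)
  have "col A t \<in> span ?S"
  proof (rule ccontr)
    assume notin: "col A t \<notin> span ?S"
    then have new: "col A t \<notin> ?S" using in_own_span[OF S(2)] by blast
    have "lin_indpt (?S \<union> {col A t})"
      using lin_dep_iff_in_span[OF S(2) indpt col_t(1) new] notin by blast
    then have "card (?S \<union> {col A t}) \<le> rank A"
      using S(3) col_t(2) by (intro rank_ge_card_indpt[OF A]) auto
    then show False
      using new S(1) rank card_image[OF inj] by simp
  qed
  from finite_in_span[OF S(1,2) this] obtain a where a: "lincomb a ?S = col A t"
    by (elim exE conjE)
  have "A $$ (r, t) = (\<Sum>k<m. a (f k) * A $$ (r, s k))" if "r < N" for r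
  proof -
    have "A $$ (r, t) = col A t $ r" using A t that by simp
    also have "\<dots> = (\<Sum>k<m. a (f k) * A $$ (r, s k))"
      unfolding a[symmetric] by (rule lincomb[OF that])
    finally show ?thesis .
  qed
  then show ?thesis by (intro exI[of _ "\<lambda>k. a (f k)"] allI impI)
qed

section \<open>The Choi form of a matrix map\<close>

text \<open>
  The Choi matrix with a row or column index \<open>c * n + s\<close> written as the pair \<open>(c, s)\<close>.
\<close>

definition choi_form :: "nat \<Rightarrow> ('a::zero_neq_one mat \<Rightarrow> 'a mat) \<Rightarrow> nat \<times> nat \<Rightarrow> nat \<times> nat \<Rightarrow> 'a" where
  "choi_form q \<L> x y = \<L> (unit_mat q (fst x) (fst y)) $$ (snd x, snd y)"

lemma star_linearD:
  fixes \<L> :: "'a::conjugatable_field mat \<Rightarrow> 'a mat"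
  assumes "star_linear n q \<L>"
  shows star_linear_closed: "\<And>V. V \<in> carrier_mat q q \<Longrightarrow> \<L> V \<in> carrier_mat n n"
    and star_linear_add: "\<And>V W. V \<in> carrier_mat q q \<Longrightarrow> W \<in> carrier_mat q q \<Longrightarrow> \<L> (V + W) = \<L> V + \<L> W"
    and star_linear_smult: "\<And>c V. V \<in> carrier_mat q q \<Longrightarrow> \<L> (c \<cdot>\<^sub>m V) = c \<cdot>\<^sub>m \<L> V"
    and star_linear_adjoint: "\<And>V. V \<in> carrier_mat q q \<Longrightarrow> \<L> (mat_adjoint V) = mat_adjoint (\<L> V)"
proof -
  interpret linear_map class_ring "module_mat TYPE('a) q q" "module_mat TYPE('a) n n" \<L>
    using assms unfolding star_linear_def by blast
  have "\<L> \<in> LinearCombinations.module_hom class_ring (module_mat TYPE('a) q q) (module_mat TYPE('a) n n)"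
    by (rule T_hom)
  then show "\<And>V. V \<in> carrier_mat q q \<Longrightarrow> \<L> V \<in> carrier_mat n n"
    and "\<And>V W. V \<in> carrier_mat q q \<Longrightarrow> W \<in> carrier_mat q q \<Longrightarrow> \<L> (V + W) = \<L> V + \<L> W"
    and "\<And>c V. V \<in> carrier_mat q q \<Longrightarrow> \<L> (c \<cdot>\<^sub>m V) = c \<cdot>\<^sub>m \<L> V"
    unfolding LinearCombinations.module_hom_def matrix_vs_simps by auto
  show "\<And>V. V \<in> carrier_mat q q \<Longrightarrow> \<L> (mat_adjoint V) = mat_adjoint (\<L> V)"
    using assms unfolding star_linear_def by blast
qed

lemma unit_mat_carrier [simp]: "unit_mat q i j \<in> carrier_mat q q"
  by (simp add: unit_mat_def)

text \<open>
  \<open>V\<close> is the sum of its entries times the matrix units. Linearity speaks of two summands only, so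
  \<open>V\<close> is built up by adding one position at a time.
\<close>

lemma star_linear_entry:
  fixes \<L> :: "'a::conjugatable_field mat \<Rightarrow> 'a mat"
  assumes L: "star_linear n q \<L>" and V: "V \<in> carrier_mat q q" and st: "s < n" "t < n"
  shows "\<L> V $$ (s, t) = (\<Sum>c<q. \<Sum>d<q. V $$ (c, d) * choi_form q \<L> (c, s) (d, t))"
proof -
  define part where "part = (\<lambda>S. mat q q (\<lambda>p. if p \<in> S then V $$ p else 0))"
  have part: "part S \<in> carrier_mat q q" for S by (simp add: part_def)
  have entries: "\<L> (part S) $$ (s, t) = (\<Sum>p\<in>S. V $$ p * choi_form q \<L> (fst p, s) (snd p, t))"
    if "S \<subseteq> {..<q} \<times> {..<q}" for S
    using finite_subset[OF that] that
  proof (induction S rule: infinite_finite_induct)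
    case empty
    \<comment> \<open>Homogeneity gives that the zero matrix is mapped to the zero matrix.\<close>
    have "part {} = 0 \<cdot>\<^sub>m part {}" by (auto simp: part_def)
    then have "\<L> (part {}) = 0 \<cdot>\<^sub>m \<L> (part {})"
      using star_linear_smult[OF L part] by metis
    then have "\<L> (part {}) $$ (s, t) = (0 \<cdot>\<^sub>m \<L> (part {})) $$ (s, t)" by (rule arg_cong)
    then show ?case using star_linear_closed[OF L part, of "{}"] st by simp
  next
    case (insert p S)
    let ?E = "unit_mat q (fst p) (snd p) :: 'a mat"
    have "part (insert p S) = V $$ p \<cdot>\<^sub>m ?E + part S"
      using insert.hyps(2) insert.prems by (intro eq_matI) (auto simp: part_def unit_mat_def)
    then have "\<L> (part (insert p S)) = V $$ p \<cdot>\<^sub>m \<L> ?E + \<L> (part S)"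
      using star_linear_add[OF L _ part] star_linear_smult[OF L] by simp
    then have "\<L> (part (insert p S)) $$ (s, t) = V $$ p * \<L> ?E $$ (s, t) + \<L> (part S) $$ (s, t)"
      using star_linear_closed[OF L part, of S] star_linear_closed[OF L, of ?E] st by simp
    then show ?case
      using insert by (simp add: choi_form_def)
  qed simp
  have "part ({..<q} \<times> {..<q}) = V"
    using V by (intro eq_matI) (auto simp: part_def)
  then show ?thesis
    using entries[OF subset_refl] by (simp add: sum.cartesian_product')
qed

lemma choi_form_hermitian:
  fixes \<L> :: "'a::conjugatable_field mat \<Rightarrow> 'a mat"
  assumes L: "star_linear n q \<L>"
  shows "hermitian_form ({..<q} \<times> {..<n}) (choi_form q \<L>)"
  unfolding hermitian_form_def
proof (intro ballI)
  fix x y assume xy: "x \<in> {..<q} \<times> {..<n}" "y \<in> {..<q} \<times> {..<n}"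
  let ?E = "unit_mat q (fst y) (fst x) :: 'a mat"
  have dims: "dim_row (unit_mat q i j :: 'a mat) = q" "dim_col (unit_mat q i j :: 'a mat) = q" for i j
    by (simp_all add: unit_mat_def)
  have "unit_mat q (fst x) (fst y) = mat_adjoint ?E"
  proof (rule eq_matI)
    fix i j assume "i < dim_row (mat_adjoint ?E)" "j < dim_col (mat_adjoint ?E)"
    then have "i < q" "j < q" by (simp_all add: mat_adjoint_def unit_mat_def)
    then show "unit_mat q (fst x) (fst y) $$ (i, j) = mat_adjoint ?E $$ (i, j)"
      by (simp add: index_mat_adjoint dims) (simp add: unit_mat_def conjugate_one)
  qed (simp_all add: mat_adjoint_def unit_mat_def)
  then have "\<L> (unit_mat q (fst x) (fst y)) = mat_adjoint (\<L> ?E)"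
    using star_linear_adjoint[OF L] by simp
  then show "choi_form q \<L> x y = conjugate (choi_form q \<L> y x)"
    using xy star_linear_closed[OF L, of ?E]
    by (auto simp: choi_form_def index_mat_adjoint)
qed

text \<open>
  By linearity the block matrix of the \<open>\<L> (V a b)\<close> is the contraction of the block matrix \<open>V\<close> with the
  Choi form, and contraction preserves nonnegativity.
\<close>

lemma completely_positive_if_nonneg_choi_form:
  fixes \<L> :: "'a::{conjugatable_ordered_field, ordered_comm_ring} mat \<Rightarrow> 'a mat"
  assumes L: "star_linear n q \<L>" and nonneg: "nonneg_form ({..<q} \<times> {..<n}) (choi_form q \<L>)"
  shows "completely_positive_map n q \<L>"
  unfolding completely_positive_map_def
proof (intro allI impI)
  fix k :: nat and V :: "nat \<Rightarrow> nat \<Rightarrow> 'a mat"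
  assume V: "\<forall>a<k. \<forall>b<k. V a b \<in> carrier_mat q q" and psd: "psd_mat (k * q) (block_mat k q V)"
  have herm_V: "V a b = mat_adjoint (V b a)" if "a < k" "b < k" for a b
  proof (rule eq_matI)
    fix i j assume "i < dim_row (mat_adjoint (V b a))" "j < dim_col (mat_adjoint (V b a))"
    then have "i < q" "j < q"
      using V that mat_adjoint_carrier[of "V b a" q q] by auto
    then have mem: "(a, i) \<in> {..<k} \<times> {..<q}" "(b, j) \<in> {..<k} \<times> {..<q}"
      and dims: "dim_col (V b a) = q" "dim_row (V b a) = q"
      using that V by auto
    have "V a b $$ (i, j) = conjugate (V b a $$ (j, i))"
      using bspec[OF bspec[OF psd[unfolded psd_block_mat_iff, THEN conjunct1, unfolded hermitian_form_def]
          mem(1)] mem(2)] by (simp only: fst_conv snd_conv)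
    also have "\<dots> = mat_adjoint (V b a) $$ (i, j)"
      using \<open>i < q\<close> \<open>j < q\<close> dims by (intro index_mat_adjoint[symmetric]) simp_all
    finally show "V a b $$ (i, j) = mat_adjoint (V b a) $$ (i, j)" .
  qed (use V that mat_adjoint_carrier[of "V b a" q q] in auto)
  let ?F = "\<lambda>x y. \<L> (V (fst x) (fst y)) $$ (snd x, snd y)"
  have "hermitian_form ({..<k} \<times> {..<n}) ?F"
    unfolding hermitian_form_def
  proof (intro ballI)
    fix x y assume xy: "x \<in> {..<k} \<times> {..<n}" "y \<in> {..<k} \<times> {..<n}"
    then have car: "V (fst y) (fst x) \<in> carrier_mat q q" using V by auto
    have "\<L> (V (fst x) (fst y)) = mat_adjoint (\<L> (V (fst y) (fst x)))"
      using herm_V[of "fst x" "fst y"] star_linear_adjoint[OF L car] xy by auto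
    then show "?F x y = conjugate (?F y x)"
      using xy star_linear_closed[OF L car] by (auto simp: index_mat_adjoint)
  qed
  moreover have "nonneg_form ({..<k} \<times> {..<n}) ?F"
  proof -
    have "nonneg_form ({..<k} \<times> {..<q}) (\<lambda>x y. V (fst x) (fst y) $$ (snd x, snd y))"
      using psd unfolding psd_block_mat_iff by (rule conjunct2)
    from nonneg_form_contract[OF _ _ _ this nonneg choi_form_hermitian[OF L]]
    have "nonneg_form ({..<k} \<times> {..<n}) (\<lambda>x y. \<Sum>c<q. \<Sum>d<q.
        V (fst x) (fst y) $$ (c, d) * choi_form q \<L> (c, snd x) (d, snd y))"
      by simp
    moreover have "?F x y = (\<Sum>c<q. \<Sum>d<q. V (fst x) (fst y) $$ (c, d) * choi_form q \<L> (c, snd x) (d, snd y))"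
      if "x \<in> {..<k} \<times> {..<n}" "y \<in> {..<k} \<times> {..<n}" for x y
      using V that by (intro star_linear_entry[OF L]) auto
    ultimately show ?thesis by (subst nonneg_form_cong)
  qed
  ultimately show "psd_mat (k * n) (block_mat k n (\<lambda>a b. \<L> (V a b)))"
    unfolding psd_block_mat_iff by (rule conjI)
qed

text \<open>
  The value of the Choi form at the product vector \<open>z \<otimes> x\<close> equals \<open>x\<^sup>* \<L>(V) x\<close> for the rank one matrix
  \<open>V\<close> with entries \<open>conjugate (z b) * z j\<close>, which is positive semidefinite.
\<close>

lemma positive_map_choi_form_product:
  fixes \<L> :: "'a::{conjugatable_ordered_field, ordered_comm_ring} mat \<Rightarrow> 'a mat"
  assumes L: "star_linear n q \<L>" and pos: "positive_map n q \<L>"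
  shows "0 \<le> (\<Sum>p\<in>{..<q} \<times> {..<n}. \<Sum>r\<in>{..<q} \<times> {..<n}.
    conjugate (z (fst p) * x (snd p)) * choi_form q \<L> p r * (z (fst r) * x (snd r)))"
proof -
  define V where "V = mat q q (\<lambda>(b, j). conjugate (z b) * z j)"
  have V: "V \<in> carrier_mat q q" by (simp add: V_def)
  have "psd_mat q V"
    unfolding psd_mat_iff
  proof (intro conjI V)
    show "hermitian_form {..<q} (\<lambda>i j. V $$ (i, j))"
      by (auto simp: hermitian_form_def V_def conjugate_dist_mul mult.commute)
    show "nonneg_form {..<q} (\<lambda>i j. V $$ (i, j))"
      unfolding nonneg_form_def
    proof
      fix v :: "nat \<Rightarrow> 'a"
      have "(\<Sum>i<q. \<Sum>j<q. conjugate (v i) * V $$ (i, j) * v j) =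
          (\<Sum>i<q. \<Sum>j<q. conjugate (z i * v i) * (z j * v j))"
        by (intro sum.cong refl) (simp add: V_def conjugate_dist_mul ac_simps)
      also have "\<dots> = (\<Sum>i<q. conjugate (z i * v i)) * (\<Sum>j<q. z j * v j)"
        by (rule sum_product[symmetric])
      also have "\<dots> = (\<Sum>j<q. z j * v j) * conjugate (\<Sum>i<q. z i * v i)"
        by (simp only: sum_conjugate[OF finite_lessThan] mult.commute)
      finally show "0 \<le> (\<Sum>i<q. \<Sum>j<q. conjugate (v i) * V $$ (i, j) * v j)"
        by (simp only: conjugate_square_positive)
    qed
  qed
  then have "psd_mat n (\<L> V)" using pos unfolding positive_map_def by blast
  then have "0 \<le> (\<Sum>a<n. \<Sum>i<n. conjugate (x a) * \<L> V $$ (a, i) * x i)"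
    unfolding psd_mat_iff nonneg_form_def by blast
  also have "\<dots> = (\<Sum>a<n. \<Sum>i<n. \<Sum>b<q. \<Sum>j<q.
      conjugate (z b * x a) * choi_form q \<L> (b, a) (j, i) * (z j * x i))"
  proof (intro sum.cong refl)
    fix a i assume "a \<in> {..<n}" "i \<in> {..<n}"
    then have "\<L> V $$ (a, i) = (\<Sum>b<q. \<Sum>j<q. V $$ (b, j) * choi_form q \<L> (b, a) (j, i))"
      by (intro star_linear_entry[OF L V]) auto
    then show "conjugate (x a) * \<L> V $$ (a, i) * x i = (\<Sum>b<q. \<Sum>j<q.
        conjugate (z b * x a) * choi_form q \<L> (b, a) (j, i) * (z j * x i))"
      by (simp add: V_def sum_distrib_left sum_distrib_right conjugate_dist_mul ac_simps)
  qed
  also have "\<dots> = (\<Sum>b<q. \<Sum>j<q. \<Sum>a<n. \<Sum>i<n.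
      conjugate (z b * x a) * choi_form q \<L> (b, a) (j, i) * (z j * x i))"
    by (rule sum_swap_pairs)
  also have "\<dots> = (\<Sum>b<q. \<Sum>a<n. \<Sum>j<q. \<Sum>i<n.
      conjugate (z b * x a) * choi_form q \<L> (b, a) (j, i) * (z j * x i))"
    by (rule sum.cong[OF refl], rule sum.swap)
  finally show ?thesis by (simp add: sum.cartesian_product')
qed

lemma mult_mat_unit_vec:
  fixes A :: "'a::semiring_1 mat"
  assumes "A \<in> carrier_mat nr nc" "j < nc"
  shows "A *\<^sub>v unit_vec nc j = col A j"
  using assms by (intro eq_vecI) (auto simp: scalar_prod_right_unit)

lemma vec_stack_unit_mat:
  assumes "b < q" "j < q"
  shows "vec_stack (unit_mat q b j) = unit_vec (q\<^sup>2) (j * q + b)"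
proof (rule eq_vecI)
  fix s assume "s < dim_vec (unit_vec (q\<^sup>2) (j * q + b))"
  then have s: "s < q * q" by (simp add: power2_eq_square)
  then have "s mod q < q" "s div q < q" using assms by (auto simp: less_mult_imp_div_less)
  moreover have "s = j * q + b \<longleftrightarrow> (s mod q, s div q) = (b, j)"
    using assms by (auto simp: mult.commute)
  ultimately show "vec_stack (unit_mat q b j) $ s = unit_vec (q\<^sup>2) (j * q + b) $ s"
    using s by (simp add: vec_stack_def unit_mat_def unit_vec_def power2_eq_square)
qed (simp add: vec_stack_def unit_mat_def power2_eq_square)

text \<open>
  The blocks of the matricization are the columns of the Choi matrix: both list the numbers
  \<open>\<L>(E\<^sub>b\<^sub>j)\<^sub>a\<^sub>i\<close> for fixed \<open>(i, j)\<close>. The matricization is a definite description, so its explicit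
  form has to be shown to be the only matrix with the defining property; this follows by
  testing it on the matrix units.
\<close>

lemma matricization_block_entries:
  fixes \<L> :: "'a::conjugatable_field mat \<Rightarrow> 'a mat"
  assumes L: "star_linear n q \<L>" and ij: "i < n" "j < q"
  shows "matricization_block n q \<L> i j = mat n q (\<lambda>(a, b). choi_form q \<L> (b, a) (j, i))"
proof -
  define M where "M = mat (n\<^sup>2) (q\<^sup>2)
    (\<lambda>(r, s). choi_form q \<L> (s mod q, r mod n) (s div q, r div n))"
  have M: "M \<in> carrier_mat (n\<^sup>2) (q\<^sup>2)" by (simp add: M_def)
  have M_vec: "M *\<^sub>v vec_stack V = vec_stack (\<L> V)" if V: "V \<in> carrier_mat q q" for V
  proof (rule eq_vecI)
    note LV = star_linear_closed[OF L V]
    fix r assume "r < dim_vec (vec_stack (\<L> V))"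
    then have r: "r < n * n" using LV by (simp add: vec_stack_def)
    then have r': "r mod n < n" "r div n < n"
      by (cases "n = 0"; simp add: less_mult_imp_div_less)+
    have "(M *\<^sub>v vec_stack V) $ r = (\<Sum>s<q * q. M $$ (r, s) * vec_stack V $ s)"
      using r V by (simp add: M_def scalar_prod_def vec_stack_def power2_eq_square lessThan_atLeast0)
    also have "\<dots> = (\<Sum>d<q. \<Sum>c<q. V $$ (c, d) * choi_form q \<L> (c, r mod n) (d, r div n))"
      unfolding sum_pair_index
      using r V by (intro sum.cong refl)
        (simp add: M_def vec_stack_def power2_eq_square pair_index_less mult.commute)
    also have "\<dots> = \<L> V $$ (r mod n, r div n)"
      unfolding star_linear_entry[OF L V r'] by (rule sum.swap)
    finally show "(M *\<^sub>v vec_stack V) $ r = vec_stack (\<L> V) $ r"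
      using LV r by (simp add: vec_stack_def)
  qed (use star_linear_closed[OF L V] in \<open>simp add: M_def vec_stack_def power2_eq_square\<close>)
  have "matricization n q \<L> = M"
    unfolding matricization_def
  proof (rule the_equality)
    show "M \<in> carrier_mat (n\<^sup>2) (q\<^sup>2) \<and> (\<forall>V\<in>carrier_mat q q. M *\<^sub>v vec_stack V = vec_stack (\<L> V))"
      using M M_vec by blast
    fix M' assume M': "M' \<in> carrier_mat (n\<^sup>2) (q\<^sup>2) \<and>
      (\<forall>V\<in>carrier_mat q q. M' *\<^sub>v vec_stack V = vec_stack (\<L> V))"
    have cols: "col M' s = col M s" if "s < q\<^sup>2" for s
    proof -
      have s: "s mod q < q" "s div q < q"
        using that by (cases "q = 0"; simp add: less_mult_imp_div_less power2_eq_square)+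
      have unit: "unit_vec (q\<^sup>2) s = (vec_stack (unit_mat q (s mod q) (s div q)) :: 'a vec)"
        unfolding vec_stack_unit_mat[OF s] by simp
      have "col M' s = M' *\<^sub>v unit_vec (q\<^sup>2) s"
        using mult_mat_unit_vec[OF conjunct1[OF M'] that] by (rule sym)
      also have "\<dots> = M *\<^sub>v unit_vec (q\<^sup>2) s"
        unfolding unit using M' M_vec by simp
      also have "\<dots> = col M s"
        by (rule mult_mat_unit_vec[OF M that])
      finally show ?thesis .
    qed
    show "M' = M"
      using M M' cols by (intro mat_col_eqI) auto
  qed
  then show ?thesis
    unfolding matricization_block_def
    using ij by (intro eq_matI) (simp_all add: M_def power2_eq_square pair_index_less)
qed

section \<open>Coordinates of the blocks\<close>

lemma choi_mat_entry:
  assumes "x \<in> {..<q} \<times> {..<n}" "y \<in> {..<q} \<times> {..<n}"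
  shows "choi_mat n q \<L> $$ (fst x * n + snd x, fst y * n + snd y) = choi_form q \<L> x y"
  using assms by (auto simp: choi_mat_def block_mat_def choi_form_def pair_index_less)

lemma choi_columns_independent:
  fixes \<L> :: "'a::conjugatable_field mat \<Rightarrow> 'a mat"
  assumes L: "star_linear n q \<L>"
    and sel: "\<forall>k<m. ik k < n \<and> jk k < q"
    and indpt: "indpt_family n q m (\<lambda>k. matricization_block n q \<L> (ik k) (jk k))"
    and zero: "\<And>x. x \<in> {..<q} \<times> {..<n} \<Longrightarrow> (\<Sum>k<m. c k * choi_form q \<L> x (jk k, ik k)) = 0"
    and k: "k < m"
  shows "c k = 0"
proof (rule indpt_familyD[OF indpt _ _ k])
  show "matricization_block n q \<L> (ik k) (jk k) \<in> carrier_mat n q" for k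
    by (simp add: matricization_block_def)
  fix a b assume ab: "a < n" "b < q"
  have "(\<Sum>k<m. c k * matricization_block n q \<L> (ik k) (jk k) $$ (a, b)) =
      (\<Sum>k<m. c k * choi_form q \<L> (b, a) (jk k, ik k))"
    using sel ab by (intro sum.cong refl) (simp add: matricization_block_entries[OF L])
  then show "(\<Sum>k<m. c k * matricization_block n q \<L> (ik k) (jk k) $$ (a, b)) = 0"
    using zero[of "(b, a)"] ab by simp
qed

lemma choi_columns_span:
  fixes \<L> :: "'a::conjugatable_field mat \<Rightarrow> 'a mat"
  assumes L: "star_linear n q \<L>" and m: "m = vec_space.rank (q * n) (choi_mat n q \<L>)"
    and sel: "\<forall>k<m. ik k < n \<and> jk k < q"
    and indpt: "indpt_family n q m (\<lambda>k. matricization_block n q \<L> (ik k) (jk k))"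
    and y: "y \<in> {..<q} \<times> {..<n}"
  obtains c where "\<And>x. x \<in> {..<q} \<times> {..<n} \<Longrightarrow>
    choi_form q \<L> x y = (\<Sum>k<m. c k * choi_form q \<L> x (jk k, ik k))"
proof -
  have entry: "choi_mat n q \<L> $$ (fst x * n + snd x, jk k * n + ik k) = choi_form q \<L> x (jk k, ik k)"
    if "x \<in> {..<q} \<times> {..<n}" "k < m" for x k
    using choi_mat_entry[OF that(1), of "(jk k, ik k)"] sel that(2) by simp
  have "\<exists>c. \<forall>r<q * n. choi_mat n q \<L> $$ (r, fst y * n + snd y) =
      (\<Sum>k<m. c k * choi_mat n q \<L> $$ (r, jk k * n + ik k))"
  proof (rule column_expansion[OF _ m[symmetric]])
    show "choi_mat n q \<L> \<in> carrier_mat (q * n) (q * n)"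
      by (simp add: choi_mat_def block_mat_def)
    show "jk k * n + ik k < q * n" if "k < m" for k
      using sel that by (simp add: pair_index_less)
    show "fst y * n + snd y < q * n"
      using y by (auto simp: pair_index_less)
    show "c k = 0" if zero: "\<And>r. r < q * n \<Longrightarrow> (\<Sum>k<m. c k * choi_mat n q \<L> $$ (r, jk k * n + ik k)) = 0"
      and k: "k < m" for c k
    proof (rule choi_columns_independent[OF L sel indpt _ k])
      fix x assume x: "x \<in> {..<q} \<times> {..<n}"
      then have "fst x * n + snd x < q * n" by (auto simp: pair_index_less)
      from zero[OF this] show "(\<Sum>k<m. c k * choi_form q \<L> x (jk k, ik k)) = 0"
        using x by (simp add: entry)
    qed
  qed
  then obtain c where c: "\<And>r. r < q * n \<Longrightarrow> choi_mat n q \<L> $$ (r, fst y * n + snd y) =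
      (\<Sum>k<m. c k * choi_mat n q \<L> $$ (r, jk k * n + ik k))"
    by blast
  have "choi_form q \<L> x y = (\<Sum>k<m. c k * choi_form q \<L> x (jk k, ik k))"
    if x: "x \<in> {..<q} \<times> {..<n}" for x
  proof -
    have "fst x * n + snd x < q * n" using x by (auto simp: pair_index_less)
    from c[OF this] show ?thesis
      using x by (simp add: entry choi_mat_entry[OF x y])
  qed
  then show thesis by (rule that)
qed

text \<open>
  Existence of the coordinates comes from the rank of the Choi matrix, uniqueness from independence
  of the selected blocks; together they make the definite description in \<open>block_coeffs\<close>
  meaningful.
\<close>

lemma block_coeffs_expansion:
  fixes \<L> :: "'a::conjugatable_field mat \<Rightarrow> 'a mat"
  assumes L: "star_linear n q \<L>" and m: "m = vec_space.rank (q * n) (choi_mat n q \<L>)"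
    and sel: "\<forall>k<m. ik k < n \<and> jk k < q"
    and indpt: "indpt_family n q m (\<lambda>k. matricization_block n q \<L> (ik k) (jk k))"
    and ij: "i < n" "j < q" and x: "x \<in> {..<q} \<times> {..<n}"
  shows "choi_form q \<L> x (j, i) =
    (\<Sum>k<m. block_coeffs n q \<L> m ik jk i j $ k * choi_form q \<L> x (jk k, ik k))"
proof -
  define expands where "expands = (\<lambda>\<alpha> :: 'a vec. \<alpha> \<in> carrier_vec m \<and>
    (\<forall>x\<in>{..<q} \<times> {..<n}. choi_form q \<L> x (j, i) = (\<Sum>k<m. \<alpha> $ k * choi_form q \<L> x (jk k, ik k))))"
  have block: "matricization_block n q \<L> i j = mat n q (\<lambda>(a, b). choi_form q \<L> (b, a) (j, i))"
    by (rule matricization_block_entries[OF L ij])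
  have combination: "finsum (module_mat TYPE('a) n q)
      (\<lambda>k. \<alpha> $ k \<cdot>\<^sub>m matricization_block n q \<L> (ik k) (jk k)) {..<m} =
      mat n q (\<lambda>(a, b). \<Sum>k<m. \<alpha> $ k * choi_form q \<L> (b, a) (jk k, ik k))" for \<alpha>
  proof -
    have "finsum (module_mat TYPE('a) n q)
        (\<lambda>k. \<alpha> $ k \<cdot>\<^sub>m matricization_block n q \<L> (ik k) (jk k)) {..<m} =
        mat n q (\<lambda>p. \<Sum>k<m. (\<alpha> $ k \<cdot>\<^sub>m matricization_block n q \<L> (ik k) (jk k)) $$ p)"
      by (rule finsum_module_mat) (simp_all add: matricization_block_def)
    also have "\<dots> = mat n q (\<lambda>(a, b). \<Sum>k<m. \<alpha> $ k * choi_form q \<L> (b, a) (jk k, ik k))"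
      using sel by (intro eq_matI) (auto simp: matricization_block_entries[OF L] intro!: sum.cong)
    finally show ?thesis .
  qed
  have expands_iff: "expands \<alpha> \<longleftrightarrow> \<alpha> \<in> carrier_vec m \<and> matricization_block n q \<L> i j =
      finsum (module_mat TYPE('a) n q)
        (\<lambda>k. \<alpha> $ k \<cdot>\<^sub>m matricization_block n q \<L> (ik k) (jk k)) {..<m}" for \<alpha>
    unfolding block combination expands_def mat_eq_iff by auto
  obtain c where c: "\<And>x. x \<in> {..<q} \<times> {..<n} \<Longrightarrow>
      choi_form q \<L> x (j, i) = (\<Sum>k<m. c k * choi_form q \<L> x (jk k, ik k))"
    using choi_columns_span[OF L m sel indpt, of "(j, i)"] ij by auto
  have "expands (vec m c)"
    unfolding expands_def using c by simp
  moreover have "\<alpha> = vec m c" if \<alpha>: "expands \<alpha>" for \<alpha>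
  proof (rule eq_vecI)
    fix k assume "k < dim_vec (vec m c)"
    then have "k < m" by simp
    \<comment> \<open>The difference of two expansions is a vanishing combination of independent columns.\<close>
    have "\<alpha> $ k - c k = 0"
    proof (rule choi_columns_independent[OF L sel indpt _ \<open>k < m\<close>])
      fix x assume "x \<in> {..<q} \<times> {..<n}"
      then have "(\<Sum>k<m. \<alpha> $ k * choi_form q \<L> x (jk k, ik k)) = (\<Sum>k<m. c k * choi_form q \<L> x (jk k, ik k))"
        using \<alpha> c unfolding expands_def by metis
      then show "(\<Sum>k<m. (\<alpha> $ k - c k) * choi_form q \<L> x (jk k, ik k)) = 0"
        by (simp add: left_diff_distrib sum_subtractf)
    qed
    then show "\<alpha> $ k = vec m c $ k" using \<open>k < m\<close> by simp
  qed (use \<alpha> in \<open>simp add: expands_def\<close>)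
  ultimately have "expands (block_coeffs n q \<L> m ik jk i j)"
    unfolding block_coeffs_def expands_iff[symmetric] by (rule theI)
  then show ?thesis using x unfolding expands_def by blast
qed

lemma block_coeffs_selected:
  fixes \<L> :: "'a::conjugatable_field mat \<Rightarrow> 'a mat"
  assumes L: "star_linear n q \<L>" and m: "m = vec_space.rank (q * n) (choi_mat n q \<L>)"
    and sel: "\<forall>k<m. ik k < n \<and> jk k < q"
    and indpt: "indpt_family n q m (\<lambda>k. matricization_block n q \<L> (ik k) (jk k))"
    and kl: "k < m" "l < m"
  shows "block_coeffs n q \<L> m ik jk (ik l) (jk l) $ k = (if k = l then 1 else 0)"
proof -
  let ?\<alpha> = "\<lambda>k. block_coeffs n q \<L> m ik jk (ik l) (jk l) $ k"
  have "?\<alpha> k - (if k = l then 1 else 0) = 0"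
  proof (rule choi_columns_independent[OF L sel indpt _ kl(1)])
    fix x assume x: "x \<in> {..<q} \<times> {..<n}"
    have "choi_form q \<L> x (jk l, ik l) = (\<Sum>k<m. ?\<alpha> k * choi_form q \<L> x (jk k, ik k))"
      using sel kl(2) by (intro block_coeffs_expansion[OF L m sel indpt _ _ x]) auto
    moreover have "(\<Sum>k<m. (if k = l then 1 else 0) * choi_form q \<L> x (jk k, ik k)) =
        (\<Sum>k<m. if k = l then choi_form q \<L> x (jk k, ik k) else 0)"
      by (intro sum.cong) auto
    ultimately show "(\<Sum>k<m. (?\<alpha> k - (if k = l then 1 else 0)) * choi_form q \<L> x (jk k, ik k)) = 0"
      using kl(2) by (simp add: left_diff_distrib sum_subtractf)
  qed
  then show ?thesis by simp
qed

lemma A_hat_mult_kron_vec: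
  fixes \<L> :: "'a::conjugatable_field mat \<Rightarrow> 'a mat"
  assumes z: "z \<in> carrier_vec q" and x: "x \<in> carrier_vec n"
  shows "A_hat n q \<L> m ik jk *\<^sub>v kron_vec z x = vec m (\<lambda>k. \<Sum>p\<in>{..<q} \<times> {..<n}.
    block_coeffs n q \<L> m ik jk (snd p) (fst p) $ k * (z $ fst p * x $ snd p))"
proof (rule eq_vecI)
  let ?vs = "map (\<lambda>k. vec_stack (coeff_mat n q \<L> m ik jk k)) [0..<m]"
  have dims: "dim_row (A_hat n q \<L> m ik jk) = m" "dim_col (A_hat n q \<L> m ik jk) = q * n"
    by (simp_all add: A_hat_def mat_adjoint_def mult.commute)
  then show "dim_vec (A_hat n q \<L> m ik jk *\<^sub>v kron_vec z x) = dim_vec (vec m (\<lambda>k. \<Sum>p\<in>{..<q} \<times> {..<n}.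
    block_coeffs n q \<L> m ik jk (snd p) (fst p) $ k * (z $ fst p * x $ snd p)))"
    by simp
  fix k assume "k < dim_vec (vec m (\<lambda>k. \<Sum>p\<in>{..<q} \<times> {..<n}.
    block_coeffs n q \<L> m ik jk (snd p) (fst p) $ k * (z $ fst p * x $ snd p)))"
  then have k: "k < m" by simp
  have entry: "A_hat n q \<L> m ik jk $$ (k, j * n + i) = block_coeffs n q \<L> m ik jk i j $ k"
    if "j < q" "i < n" for i j
  proof -
    have r: "j * n + i < n * q"
      using pair_index_less[OF that] by (simp add: mult.commute)
    have "A_hat n q \<L> m ik jk $$ (k, j * n + i) = conjugate (mat_of_cols (n * q) ?vs $$ (j * n + i, k))"
      unfolding A_hat_def using k r by (intro index_mat_adjoint) simp_all
    also have "\<dots> = conjugate (vec_stack (coeff_mat n q \<L> m ik jk k) $ (j * n + i))"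
      using k r by (simp add: mat_of_cols_index)
    also have "\<dots> = block_coeffs n q \<L> m ik jk i j $ k"
      using r that by (simp add: vec_stack_def coeff_mat_def)
    finally show ?thesis .
  qed
  have "(A_hat n q \<L> m ik jk *\<^sub>v kron_vec z x) $ k =
      (\<Sum>r<q * n. A_hat n q \<L> m ik jk $$ (k, r) * kron_vec z x $ r)"
    using k dims z x by (simp add: scalar_prod_def kron_vec_def lessThan_atLeast0)
  also have "\<dots> = (\<Sum>j<q. \<Sum>i<n. block_coeffs n q \<L> m ik jk i j $ k * (z $ j * x $ i))"
    unfolding sum_pair_index using z x
    by (intro sum.cong refl) (simp add: entry kron_vec_def pair_index_less)
  finally show "(A_hat n q \<L> m ik jk *\<^sub>v kron_vec z x) $ k = vec m (\<lambda>k. \<Sum>p\<in>{..<q} \<times> {..<n}.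
    block_coeffs n q \<L> m ik jk (snd p) (fst p) $ k * (z $ fst p * x $ snd p)) $ k"
    using k by (simp add: sum.cartesian_product')
qed

text \<open>
  The vector \<open>W = \<Sum>\<^sub>k y\<^sub>k (e\<^bsub>j k\<^esub> \<otimes> e\<^bsub>i k\<^esub>)\<close> is mapped to \<open>y\<close>. If all \<open>i\<^sub>k\<close> equal \<open>i\<^sub>0\<close>, it factors as
  \<open>(\<Sum>\<^sub>k y\<^sub>k e\<^bsub>j k\<^esub>) \<otimes> e\<^bsub>i 0\<^esub>\<close>, and symmetrically if all \<open>j\<^sub>k\<close> agree.
\<close>

lemma kron_image_full_if_selection_on_line:
  fixes \<L> :: "'a::conjugatable_field mat \<Rightarrow> 'a mat"
  assumes L: "star_linear n q \<L>" and m: "m = vec_space.rank (q * n) (choi_mat n q \<L>)"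
    and sel: "\<forall>k<m. ik k < n \<and> jk k < q"
    and indpt: "indpt_family n q m (\<lambda>k. matricization_block n q \<L> (ik k) (jk k))"
    and line: "(\<forall>k<m. \<forall>l<m. ik k = ik l) \<or> (\<forall>k<m. \<forall>l<m. jk k = jk l)"
  shows "kron_image n q (A_hat n q \<L> m ik jk) = carrier_vec m"
proof (intro equalityI subsetI)
  fix y assume "y \<in> kron_image n q (A_hat n q \<L> m ik jk)"
  then show "y \<in> carrier_vec m"
    unfolding kron_image_def using A_hat_mult_kron_vec by fastforce
next
  fix y :: "'a vec" assume y: "y \<in> carrier_vec m"
  define W where "W = (\<lambda>p. \<Sum>k<m. if p = (jk k, ik k) then y $ k else 0)"
  obtain z x where zx: "z \<in> carrier_vec q" "x \<in> carrier_vec n"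
    and W: "\<And>p. p \<in> {..<q} \<times> {..<n} \<Longrightarrow> z $ fst p * x $ snd p = W p"
  proof (cases "\<forall>k<m. \<forall>l<m. ik k = ik l")
    case True
    \<comment> \<open>If \<open>m = 0\<close>, then \<open>i0\<close> is arbitrary and \<open>W\<close> is an empty sum.\<close>
    obtain i0 where i0: "\<And>k. k < m \<Longrightarrow> ik k = i0"
      using True by (cases m) blast+
    have "(\<Sum>k<m. if fst p = jk k then y $ k else 0) * (if snd p = i0 then 1 else 0) = W p" for p
      using i0 by (auto simp: W_def prod_eq_iff intro!: sum.cong sum.neutral)
    then show thesis
      by (intro that[of "vec q (\<lambda>j. \<Sum>k<m. if j = jk k then y $ k else 0)"
            "vec n (\<lambda>i. if i = i0 then 1 else 0)"]) (simp_all add: mem_Times_iff)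
  next
    case False
    then obtain j0 where j0: "\<And>k. k < m \<Longrightarrow> jk k = j0"
      using line by (cases m) blast+
    have "(if fst p = j0 then 1 else 0) * (\<Sum>k<m. if snd p = ik k then y $ k else 0) = W p" for p
      using j0 by (auto simp: W_def prod_eq_iff intro!: sum.cong sum.neutral)
    then show thesis
      by (intro that[of "vec q (\<lambda>j. if j = j0 then 1 else 0)"
            "vec n (\<lambda>i. \<Sum>k<m. if i = ik k then y $ k else 0)"]) (simp_all add: mem_Times_iff)
  qed
  have "A_hat n q \<L> m ik jk *\<^sub>v kron_vec z x = y"
    unfolding A_hat_mult_kron_vec[OF zx]
  proof (rule eq_vecI)
    fix k assume "k < dim_vec y"
    then have k: "k < m" using y by simp
    have "(\<Sum>p\<in>{..<q} \<times> {..<n}. block_coeffs n q \<L> m ik jk (snd p) (fst p) $ k * (z $ fst p * x $ snd p)) =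
        (\<Sum>p\<in>{..<q} \<times> {..<n}. \<Sum>l<m. if p = (jk l, ik l)
           then block_coeffs n q \<L> m ik jk (snd p) (fst p) $ k * y $ l else 0)"
      by (intro sum.cong refl) (simp add: W W_def sum_distrib_left if_distrib cong: if_cong)
    also have "\<dots> = (\<Sum>l<m. \<Sum>p\<in>{..<q} \<times> {..<n}. if p = (jk l, ik l)
           then block_coeffs n q \<L> m ik jk (snd p) (fst p) $ k * y $ l else 0)"
      by (rule sum.swap)
    also have "\<dots> = (\<Sum>l<m. block_coeffs n q \<L> m ik jk (ik l) (jk l) $ k * y $ l)"
      using sel by (intro sum.cong refl) (simp add: sum.delta)
    also have "\<dots> = (\<Sum>l<m. if l = k then y $ l else 0)"
      using k by (intro sum.cong refl) (simp add: block_coeffs_selected[OF L m sel indpt])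
    also have "\<dots> = y $ k" using k by simp
    finally show "vec m (\<lambda>k. \<Sum>p\<in>{..<q} \<times> {..<n}.
        block_coeffs n q \<L> m ik jk (snd p) (fst p) $ k * (z $ fst p * x $ snd p)) $ k = y $ k"
      using k by simp
  qed (use y in simp)
  then show "y \<in> kron_image n q (A_hat n q \<L> m ik jk)"
    unfolding kron_image_def using zx by blast
qed

text \<open>
  The form of the product \<open>A\<^sup>* H A\<close>, where \<open>H\<close> is the submatrix of the Choi matrix on the selected rows
  and columns. The expansion of the columns gives the right factor; as the Choi matrix is Hermitian,
  the same expansion also applies to its rows and gives the left factor.
\<close>

lemma choi_form_factorization:
  fixes \<L> :: "'a::conjugatable_field mat \<Rightarrow> 'a mat"
  assumes L: "star_linear n q \<L>" and m: "m = vec_space.rank (q * n) (choi_mat n q \<L>)"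
    and sel: "\<forall>k<m. ik k < n \<and> jk k < q"
    and indpt: "indpt_family n q m (\<lambda>k. matricization_block n q \<L> (ik k) (jk k))"
    and x: "x \<in> {..<q} \<times> {..<n}" and y: "y \<in> {..<q} \<times> {..<n}"
  defines "\<alpha> \<equiv> \<lambda>k p. block_coeffs n q \<L> m ik jk (snd p) (fst p) $ k"
  shows "choi_form q \<L> x y = (\<Sum>k<m. \<Sum>l<m.
    conjugate (\<alpha> k x) * choi_form q \<L> (jk k, ik k) (jk l, ik l) * \<alpha> l y)"
proof -
  have expand: "choi_form q \<L> x y = (\<Sum>k<m. \<alpha> k y * choi_form q \<L> x (jk k, ik k))"
    if "x \<in> {..<q} \<times> {..<n}" "y \<in> {..<q} \<times> {..<n}" for x y
    using block_coeffs_expansion[OF L m sel indpt _ _ that(1), of "snd y" "fst y"] that(2)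
    by (auto simp: \<alpha>_def)
  have herm: "choi_form q \<L> x y = conjugate (choi_form q \<L> y x)"
    if "x \<in> {..<q} \<times> {..<n}" "y \<in> {..<q} \<times> {..<n}" for x y
    using choi_form_hermitian[OF L] that unfolding hermitian_form_def by blast
  have s: "(jk l, ik l) \<in> {..<q} \<times> {..<n}" if "l < m" for l using sel that by simp
  have "choi_form q \<L> x y = (\<Sum>l<m. choi_form q \<L> x (jk l, ik l) * \<alpha> l y)"
    unfolding expand[OF x y] by (simp only: mult.commute)
  also have "\<dots> = (\<Sum>l<m. \<Sum>k<m. conjugate (\<alpha> k x) * choi_form q \<L> (jk k, ik k) (jk l, ik l) * \<alpha> l y)"
  proof (rule sum.cong[OF refl])
    fix l assume "l \<in> {..<m}"
    then have l: "(jk l, ik l) \<in> {..<q} \<times> {..<n}" using s by simp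
    have "choi_form q \<L> x (jk l, ik l) = conjugate (\<Sum>k<m. \<alpha> k x * choi_form q \<L> (jk l, ik l) (jk k, ik k))"
      unfolding herm[OF x l] expand[OF l x] ..
    also have "\<dots> = (\<Sum>k<m. conjugate (\<alpha> k x) * choi_form q \<L> (jk k, ik k) (jk l, ik l))"
      unfolding sum_conjugate[OF finite_lessThan] conjugate_dist_mul
      using herm[OF s l] by (intro sum.cong refl) simp
    finally show "choi_form q \<L> x (jk l, ik l) * \<alpha> l y =
        (\<Sum>k<m. conjugate (\<alpha> k x) * choi_form q \<L> (jk k, ik k) (jk l, ik l) * \<alpha> l y)"
      by (simp only: sum_distrib_right)
  qed
  finally show ?thesis by (subst sum.swap)
qed

theorem completely_positive_if_kron_image_full:
  fixes \<L> :: "'a::{conjugatable_ordered_field, ordered_comm_ring} mat \<Rightarrow> 'a mat"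
  assumes L: "star_linear n q \<L>" and m: "m = vec_space.rank (q * n) (choi_mat n q \<L>)"
    and sel: "\<forall>k<m. ik k < n \<and> jk k < q"
    and indpt: "indpt_family n q m (\<lambda>k. matricization_block n q \<L> (ik k) (jk k))"
    and full: "kron_image n q (A_hat n q \<L> m ik jk) = carrier_vec m"
    and pos: "positive_map n q \<L>"
  shows "completely_positive_map n q \<L>"
proof -
  define W where "W = {\<lambda>p. z $ fst p * x $ snd p | z x :: 'a vec. z \<in> carrier_vec q \<and> x \<in> carrier_vec n}"
  have "nonneg_form ({..<q} \<times> {..<n}) (choi_form q \<L>)"
  proof (rule nonneg_form_if_factor_exhausted[of _ "{..<m}", OF _ _ choi_form_factorization[OF L m sel indpt]])
    fix w :: "nat \<times> nat \<Rightarrow> 'a" assume "w \<in> W"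
    then show "0 \<le> (\<Sum>i\<in>{..<q} \<times> {..<n}. \<Sum>j\<in>{..<q} \<times> {..<n}. conjugate (w i) * choi_form q \<L> i j * w j)"
      using positive_map_choi_form_product[OF L pos] unfolding W_def by auto
  next
    fix y :: "nat \<Rightarrow> 'a"
    have "vec m y \<in> kron_image n q (A_hat n q \<L> m ik jk)"
      unfolding full by simp
    then obtain z x where zx: "z \<in> carrier_vec q" "x \<in> carrier_vec n"
      and y: "vec m y = A_hat n q \<L> m ik jk *\<^sub>v kron_vec z x"
      unfolding kron_image_def by blast
    have "(\<Sum>p\<in>{..<q} \<times> {..<n}. block_coeffs n q \<L> m ik jk (snd p) (fst p) $ k * (z $ fst p * x $ snd p)) = y k"
      if "k < m" for k
    proof -
      have "vec m y $ k = y k" using that by simp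
      then show ?thesis unfolding y A_hat_mult_kron_vec[OF zx] using that by simp
    qed
    moreover have "(\<lambda>p. z $ fst p * x $ snd p) \<in> W" using zx unfolding W_def by blast
    ultimately show "\<exists>w\<in>W. \<forall>k\<in>{..<m}. (\<Sum>p\<in>{..<q} \<times> {..<n}.
        block_coeffs n q \<L> m ik jk (snd p) (fst p) $ k * w p) = y k"
      by (intro bexI[of _ "\<lambda>p. z $ fst p * x $ snd p"]) auto
  qed auto
  then show ?thesis by (rule completely_positive_if_nonneg_choi_form[OF L])
qed

theorem kron_image_full_and_completely_positive:
  fixes \<L> :: "'a::{conjugatable_ordered_field, ordered_comm_ring} mat \<Rightarrow> 'a mat"
  assumes L: "star_linear n q \<L>" and m: "m = vec_space.rank (q * n) (choi_mat n q \<L>)"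
    and sel: "\<forall>k<m. ik k < n \<and> jk k < q"
    and indpt: "indpt_family n q m (\<lambda>k. matricization_block n q \<L> (ik k) (jk k))"
    and line: "(\<forall>k<m. \<forall>l<m. ik k = ik l) \<or> (\<forall>k<m. \<forall>l<m. jk k = jk l)"
  shows "kron_image n q (A_hat n q \<L> m ik jk) = carrier_vec m \<and>
    (positive_map n q \<L> \<longrightarrow> completely_positive_map n q \<L>)"
  using kron_image_full_if_selection_on_line[OF assms]
    completely_positive_if_kron_image_full[OF L m sel indpt] by (intro conjI impI)

theorem proposition3p26:
  fixes n q :: nat
  assumes "n \<ge> 1" and "q \<ge> 1"
  shows "(\<forall>(\<L> :: complex mat \<Rightarrow> complex mat) m ik jk.
       star_linear n q \<L> \<longrightarrow>
       m = vec_space.rank (q * n) (choi_mat n q \<L>) \<longrightarrow>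
       (\<forall>k<m. ik k < n \<and> jk k < q) \<longrightarrow>
       indpt_family n q m (\<lambda>k. matricization_block n q \<L> (ik k) (jk k)) \<longrightarrow>
       (\<forall>k<m. \<forall>l<m. ik k = ik l) \<or> (\<forall>k<m. \<forall>l<m. jk k = jk l) \<longrightarrow>
       kron_image n q (A_hat n q \<L> m ik jk) = carrier_vec m \<and>
       (positive_map n q \<L> \<longrightarrow> completely_positive_map n q \<L>)) \<and>
     (\<forall>(\<L> :: real mat \<Rightarrow> real mat) m ik jk.
       star_linear n q \<L> \<longrightarrow>
       m = vec_space.rank (q * n) (choi_mat n q \<L>) \<longrightarrow>
       (\<forall>k<m. ik k < n \<and> jk k < q) \<longrightarrow>
       indpt_family n q m (\<lambda>k. matricization_block n q \<L> (ik k) (jk k)) \<longrightarrow>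
       (\<forall>k<m. \<forall>l<m. ik k = ik l) \<or> (\<forall>k<m. \<forall>l<m. jk k = jk l) \<longrightarrow>
       kron_image n q (A_hat n q \<L> m ik jk) = carrier_vec m \<and>
       (positive_map n q \<L> \<longrightarrow> completely_positive_map n q \<L>))"
  by (rule conjI; intro allI impI; rule kron_image_full_and_completely_positive; assumption)

end
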